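(* Let $G$ be a group with finite symmetric generating set $A$, and let a total ordering on $A$ be chosen (used to define shortlex normal forms). The following are equivalent: (1) The pair $(G,A)$ is almost convex. (2) The pair $(G,A)$ is geodesically stackable. (3) The pair $(G,A)$ is geodesically algorithmically stackable with respect to shortlex normal forms.
   Context: Conventions. A finite generating set $A$ of a group $G$ is symmetric if it is closed under inversion; for $a\in A$, $a^{-1}\in A$ denotes the inverse letter. Standing assumption: no element of $A$ represents the identity $\epsilon$ of $G$. $A^*$ is the set of words over $A$, and $\rho:A^*\to G$ is the canonical monoid homomorphism. Let $\Gamma=\Gamma(G,A)$ be the Cayley graph with path metric $d$, $\vec E$ its set of directed edges, and $\vec P$ its set of directed edge paths; $\lambda:\vec P\to A^*$ maps each path to the word labeling it. For $g\in G$, $a\in A$, let $e_{g,a}\in\vec E$ be the directed edge with initial vertex $g$, terminal vertex $ga$ and label $a$; put $\alpha(e_{g,a})=\frac12\left(d(\epsilon,g)+d(\epsilon,ga)\right)$. The directed edges $e_{g,a}$ and $e_{ga,a^{-1}}$ are viewed as having a single underlying undirected edge. The edges lying on a directed path are taken with the direction in which the path traverses them. Almost convexity. For $n\in\mathbb N$, $S(n)$ is the set of points of $\Gamma$ at distance exactly $n$ from $\epsilon$, and $B(n)$ is the set of points of $\Gamma$ (including points in the interiors of edges) at distance at most $n$ from $\epsilon$. $(G,A)$ is almost convex if there is a constant $k$ such that for all $n\in\mathbb N$ and all $g,h\in G$ lying in $S(n)$ with $d(g,h)\le 2$, there is a path inside $B(n)$ from $g$ to $h$ of length at most $k$. Flow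 function. A flow function associated to a maximal tree $T$ in $\Gamma$ is a function $\Phi:\vec E\to\vec P$ such that: (F1) for each $e\in\vec E$, the path $\Phi(e)$ has the same initial and terminal vertices as $e$; (F2d) if the undirected edge underlying $e$ lies in $T$, then $\Phi(e)=e$; (F2r) the transitive closure $<_\Phi$ of the relation $<$ on $\vec E$ defined by "$e'<e$ whenever $e'$ lies on the path $\Phi(e)$ and the undirected edges underlying both $e$ and $e'$ do not lie in $T$" is a well-founded strict partial ordering. A flow function is bounded if there is a constant $k$ such that for all $e\in\vec E$ the path $\Phi(e)$ has length at most $k$. The normal form set $\mathcal N\subset A^*$ associated to $\Phi$ (or to $T$) is the set of words labeling the non-backtracking paths in $T$ starting at $\epsilon$; it contains exactly one representative of each element of $G$. The set $\vec E_r$ of recursive edges consists of the directed edges whose underlying undirected edge does not lie in $T$. Geodesically stackable. $(G,A)$ is geodesically stackable if there is a bounded flow function $\Phi$ on $\Gamma(G,A)$, with associated normal form set $\mathcal N$, such that all elements of $\mathcal N$ label geodesic paths in $\Gamma$, and whenever $e',e\in\vec E_r$ with $e'<_\Phi e$, then $\alpha(e')<\alpha(e)$. Shortlex. Given a total ordering on $A$, a word $z_g\in A^*$ is the shortlex normal form of $g\in G$ if $\rho(z_g)=g$ and every other word $w\in A^*$ with $\rho(w)=g$ is either longer than $z_g$, or of the same length as $z_g$ and lexicographically greater than $z_g$. Geodesically algorithmically stackable with respect to shortlex normal forms means that there is a bounded flow function $\Phi$ as in the definition of geodesically stackable whose associated normal form set $\mathcal N$ is the set of shortlex normal forms, and for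 which the subset $$S_\Phi:=\{(w,a,\lambda(\Phi(e_{\rho(w),a})))\mid w\in A^*,\ a\in A\}$$ of $A^*\times A\times A^*$ is recursive (computable). *)

theory Defs
  imports
    Complex_Main
    "HOL-Library.Nat_Bijection"
    "HOL-Algebra.Generated_Groups"
    "Graph_Theory.Digraph_Component"
begin

section \<open>Cayley graphs\<close>

text \<open>
  Words are elements of \<^term>\<open>lists A\<close>.  The directed edge with initial vertex \<open>g\<close> and label \<open>a\<close>
  is the pair \<open>(g, a)\<close>.  A directed edge path is the list of its edges; the endpoints, in
  particular the base point of an empty path, are supplied by the arguments of
  \<^const>\<open>pre_digraph.awalk\<close>.
\<close>

definition word_val :: "('a, 'b) monoid_scheme \<Rightarrow> 'a list \<Rightarrow> 'a" where
  "word_val G w = foldr (\<lambda>x y. x \<otimes>\<^bsub>G\<^esub> y) w \<one>\<^bsub>G\<^esub>"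

definition cayley :: "('a, 'b) monoid_scheme \<Rightarrow> 'a set \<Rightarrow> ('a, 'a \<times> 'a) pre_digraph" where
  "cayley G A = \<lparr>verts = carrier G, arcs = carrier G \<times> A,
     tail = fst, head = (\<lambda>e. fst e \<otimes>\<^bsub>G\<^esub> snd e)\<rparr>"

definition path_label :: "('a \<times> 'a) list \<Rightarrow> 'a list" where
  "path_label p = map snd p"

definition rev_edge :: "('a, 'b) monoid_scheme \<Rightarrow> 'a \<times> 'a \<Rightarrow> 'a \<times> 'a" where
  "rev_edge G e = (fst e \<otimes>\<^bsub>G\<^esub> snd e, inv\<^bsub>G\<^esub> snd e)"

definition non_backtracking :: "('a, 'b) monoid_scheme \<Rightarrow> ('a \<times> 'a) list \<Rightarrow> bool" where
  "non_backtracking G p \<longleftrightarrow> (\<forall>i. Suc i < length p \<longrightarrow> p ! Suc i \<noteq> rev_edge G (p ! i))"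

definition cayley_dist :: "('a, 'b) monoid_scheme \<Rightarrow> 'a set \<Rightarrow> 'a \<Rightarrow> 'a \<Rightarrow> nat" where
  "cayley_dist G A u v =
     (LEAST n. \<exists>p. pre_digraph.awalk (cayley G A) u p v \<and> length p = n)"

definition edge_height :: "('a, 'b) monoid_scheme \<Rightarrow> 'a set \<Rightarrow> 'a \<times> 'a \<Rightarrow> real" where
  "edge_height G A e =
     (real (cayley_dist G A \<one>\<^bsub>G\<^esub> (tail (cayley G A) e))
      + real (cayley_dist G A \<one>\<^bsub>G\<^esub> (head (cayley G A) e))) / 2"

section \<open>Almost convexity\<close>

text \<open>
  The distance from the identity to the point of the edge \<open>e\<close> that divides it in the ratio
  \<open>t : 1 - t\<close>, for \<open>t\<close> in \<open>[0, 1]\<close>: every edge is isometric to the unit interval, and a path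
  from the identity reaches the point through one of the two endpoints of \<open>e\<close>.
\<close>

definition point_dist :: "('a, 'b) monoid_scheme \<Rightarrow> 'a set \<Rightarrow> 'a \<times> 'a \<Rightarrow> real \<Rightarrow> real" where
  "point_dist G A e t =
     min (real (cayley_dist G A \<one>\<^bsub>G\<^esub> (tail (cayley G A) e)) + t)
         (real (cayley_dist G A \<one>\<^bsub>G\<^esub> (head (cayley G A) e)) + (1 - t))"

definition sphere_vertices :: "('a, 'b) monoid_scheme \<Rightarrow> 'a set \<Rightarrow> nat \<Rightarrow> 'a set" where
  "sphere_vertices G A n = {g \<in> carrier G. cayley_dist G A \<one>\<^bsub>G\<^esub> g = n}"

text \<open>
  All points of the path, including those in the interiors of its edges, lie in \<open>B(n)\<close>: an edge
  joining two vertices of \<open>S(n)\<close> is not inside \<open>B(n)\<close>.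
\<close>

definition inside_ball :: "('a, 'b) monoid_scheme \<Rightarrow> 'a set \<Rightarrow> nat \<Rightarrow> 'a \<Rightarrow> ('a \<times> 'a) list \<Rightarrow> bool" where
  "inside_ball G A n u p \<longleftrightarrow>
     cayley_dist G A \<one>\<^bsub>G\<^esub> u \<le> n \<and>
     (\<forall>e \<in> set p. \<forall>t \<in> {0..1}. point_dist G A e t \<le> real n)"

definition almost_convex :: "('a, 'b) monoid_scheme \<Rightarrow> 'a set \<Rightarrow> bool" where
  "almost_convex G A \<longleftrightarrow>
     (\<exists>k::nat. \<forall>n. \<forall>g \<in> sphere_vertices G A n. \<forall>h \<in> sphere_vertices G A n.
        cayley_dist G A g h \<le> 2 \<longrightarrow>
        (\<exists>p. pre_digraph.awalk (cayley G A) g p h \<and> inside_ball G A n g p \<and> length p \<le> k))"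

section \<open>Maximal trees and flow functions\<close>

text \<open>
  An undirected graph is represented by a symmetric digraph.  In this representation an edge
  followed by its reverse is a \<^const>\<open>pre_digraph.cycle\<close> of length 2, so
  \<^const>\<open>Digraph_Component.tree\<close> is not applicable.  The Cayley graph has neither loops (the
  identity is not a generator) nor multiple edges (the generators are elements of the group), hence
  the circuits of the undirected graph are the cycles of length at least 3.
\<close>

definition undirected_tree :: "('v, 'e) pre_digraph \<Rightarrow> bool" where
  "undirected_tree T \<longleftrightarrow> symmetric T \<and> strongly_connected T \<and>
     \<not> (\<exists>p. pre_digraph.cycle T p \<and> 3 \<le> length p)"

definition maximal_tree ::
  "('a, 'b) monoid_scheme \<Rightarrow> 'a set \<Rightarrow> ('a, 'a \<times> 'a) pre_digraph \<Rightarrow> bool" where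
  "maximal_tree G A T \<longleftrightarrow> pre_digraph.max_subgraph (cayley G A) undirected_tree T"

text \<open>
  Since \<open>T\<close> is symmetric and there are no multiple edges, the undirected edge underlying \<open>e\<close> lies in
  \<open>T\<close> iff \<open>e\<close> is an arc of \<open>T\<close>.
\<close>

definition recursive_edges ::
  "('a, 'b) monoid_scheme \<Rightarrow> 'a set \<Rightarrow> ('a, 'a \<times> 'a) pre_digraph \<Rightarrow> ('a \<times> 'a) set" where
  "recursive_edges G A T = arcs (cayley G A) - arcs T"

definition flow_order ::
  "('a, 'b) monoid_scheme \<Rightarrow> 'a set \<Rightarrow> ('a, 'a \<times> 'a) pre_digraph
   \<Rightarrow> ('a \<times> 'a \<Rightarrow> ('a \<times> 'a) list) \<Rightarrow> (('a \<times> 'a) \<times> ('a \<times> 'a)) set" where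
  "flow_order G A T \<Phi> =
     {(e', e). e \<in> recursive_edges G A T \<and> e' \<in> recursive_edges G A T \<and> e' \<in> set (\<Phi> e)}\<^sup>+"

definition flow_function ::
  "('a, 'b) monoid_scheme \<Rightarrow> 'a set \<Rightarrow> ('a, 'a \<times> 'a) pre_digraph
   \<Rightarrow> ('a \<times> 'a \<Rightarrow> ('a \<times> 'a) list) \<Rightarrow> bool" where
  "flow_function G A T \<Phi> \<longleftrightarrow>
     maximal_tree G A T \<and>
     (\<forall>e \<in> arcs (cayley G A).
        pre_digraph.awalk (cayley G A) (tail (cayley G A) e) (\<Phi> e) (head (cayley G A) e)) \<and>
     (\<forall>e \<in> arcs T. \<Phi> e = [e]) \<and>
     trans (flow_order G A T \<Phi>) \<and> irrefl (flow_order G A T \<Phi>) \<and> wf (flow_order G A T \<Phi>)"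

definition bounded_flow ::
  "('a, 'b) monoid_scheme \<Rightarrow> 'a set \<Rightarrow> ('a \<times> 'a \<Rightarrow> ('a \<times> 'a) list) \<Rightarrow> bool" where
  "bounded_flow G A \<Phi> \<longleftrightarrow> (\<exists>k::nat. \<forall>e \<in> arcs (cayley G A). length (\<Phi> e) \<le> k)"

definition normal_forms ::
  "('a, 'b) monoid_scheme \<Rightarrow> ('a, 'a \<times> 'a) pre_digraph \<Rightarrow> 'a list set" where
  "normal_forms G T =
     {path_label p | p. (\<exists>g. pre_digraph.awalk T \<one>\<^bsub>G\<^esub> p g) \<and> non_backtracking G p}"

definition labels_geodesics :: "('a, 'b) monoid_scheme \<Rightarrow> 'a set \<Rightarrow> 'a list \<Rightarrow> bool" where
  "labels_geodesics G A w \<longleftrightarrow>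
     (\<forall>u p v. pre_digraph.awalk (cayley G A) u p v \<and> path_label p = w \<longrightarrow>
        length p = cayley_dist G A u v)"

definition geodesic_flow ::
  "('a, 'b) monoid_scheme \<Rightarrow> 'a set \<Rightarrow> ('a, 'a \<times> 'a) pre_digraph
   \<Rightarrow> ('a \<times> 'a \<Rightarrow> ('a \<times> 'a) list) \<Rightarrow> bool" where
  "geodesic_flow G A T \<Phi> \<longleftrightarrow>
     flow_function G A T \<Phi> \<and> bounded_flow G A \<Phi> \<and>
     (\<forall>w \<in> normal_forms G T. labels_geodesics G A w) \<and>
     (\<forall>e' \<in> recursive_edges G A T. \<forall>e \<in> recursive_edges G A T.
        (e', e) \<in> flow_order G A T \<Phi> \<longrightarrow> edge_height G A e' < edge_height G A e)"

definition geodesically_stackable :: "('a, 'b) monoid_scheme \<Rightarrow> 'a set \<Rightarrow> bool" where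
  "geodesically_stackable G A \<longleftrightarrow> (\<exists>T \<Phi>. geodesic_flow G A T \<Phi>)"

section \<open>Shortlex normal forms\<close>

text \<open>\<open>r\<close> is a reflexive total order on \<open>A\<close>; \<^const>\<open>lex\<close> only relates words of equal length.\<close>

definition shortlex_nf ::
  "('a, 'b) monoid_scheme \<Rightarrow> 'a set \<Rightarrow> ('a \<times> 'a) set \<Rightarrow> 'a \<Rightarrow> 'a list \<Rightarrow> bool" where
  "shortlex_nf G A r g z \<longleftrightarrow>
     z \<in> lists A \<and> word_val G z = g \<and>
     (\<forall>w \<in> lists A. word_val G w = g \<and> w \<noteq> z \<longrightarrow>
        length z < length w \<or> (length w = length z \<and> (z, w) \<in> lex (r - Id)))"

section \<open>Recursive sets\<close>

text \<open>
  \<open>recursive_fun n f\<close>: \<open>f\<close>, restricted to argument lists of length \<open>n\<close>, is a total recursive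
  function of \<open>n\<close> arguments.  Minimisation is applied to regular functions only; by Kleene's
  normal form theorem this yields exactly the total \<open>\<mu>\<close>-recursive functions.
\<close>

inductive recursive_fun :: "nat \<Rightarrow> (nat list \<Rightarrow> nat) \<Rightarrow> bool" where
  zero: "recursive_fun n (\<lambda>xs. 0)"
| succ: "recursive_fun 1 (\<lambda>xs. Suc (xs ! 0))"
| proj: "i < n \<Longrightarrow> recursive_fun n (\<lambda>xs. xs ! i)"
| comp: "recursive_fun (length gs) f \<Longrightarrow> \<forall>g \<in> set gs. recursive_fun n g
    \<Longrightarrow> recursive_fun n (\<lambda>xs. f (map (\<lambda>g. g xs) gs))"
| prim_rec: "recursive_fun n f \<Longrightarrow> recursive_fun (n + 2) g
    \<Longrightarrow> recursive_fun (n + 1)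
          (\<lambda>xs. rec_nat (f (tl xs)) (\<lambda>y v. g (y # v # tl xs)) (hd xs))"
| minim: "recursive_fun (n + 1) f \<Longrightarrow> \<forall>xs. length xs = n \<longrightarrow> (\<exists>y. f (y # xs) = 0)
    \<Longrightarrow> recursive_fun n (\<lambda>xs. LEAST y. f (y # xs) = 0)"
| ext: "recursive_fun n f \<Longrightarrow> \<forall>xs. length xs = n \<longrightarrow> f xs = f' xs \<Longrightarrow> recursive_fun n f'"

definition triple_code :: "('a \<Rightarrow> nat) \<Rightarrow> 'a list \<times> 'a \<times> 'a list \<Rightarrow> nat list" where
  "triple_code c = (\<lambda>(w, a, v). [list_encode (map c w), c a, list_encode (map c v)])"

text \<open>
  The letters are numbered in some way; as the alphabet \<open>A\<close> is finite, two numberings differ by a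
  recursive function, so the choice of \<open>c\<close> is irrelevant.
\<close>

definition recursive_triples :: "'a set \<Rightarrow> ('a list \<times> 'a \<times> 'a list) set \<Rightarrow> bool" where
  "recursive_triples A S \<longleftrightarrow>
     (\<exists>c. inj_on c A \<and> recursive_fun 3 (\<lambda>xs. if xs \<in> triple_code c ` S then 1 else 0))"

definition flow_graph ::
  "('a, 'b) monoid_scheme \<Rightarrow> 'a set \<Rightarrow> ('a \<times> 'a \<Rightarrow> ('a \<times> 'a) list)
   \<Rightarrow> ('a list \<times> 'a \<times> 'a list) set" where
  "flow_graph G A \<Phi> = {(w, a, path_label (\<Phi> (word_val G w, a))) | w a. w \<in> lists A \<and> a \<in> A}"

definition geodesically_algorithmically_stackable_shortlex ::
  "('a, 'b) monoid_scheme \<Rightarrow> 'a set \<Rightarrow> ('a \<times> 'a) set \<Rightarrow> bool" where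
  "geodesically_algorithmically_stackable_shortlex G A r \<longleftrightarrow>
     (\<exists>T \<Phi>. geodesic_flow G A T \<Phi> \<and>
        normal_forms G T = {z. \<exists>g \<in> carrier G. shortlex_nf G A r g z} \<and>
        recursive_triples A (flow_graph G A \<Phi>))"

end

theory Submission
  imports Defs
begin

text \<open>
  The implication from the third property to the second is immediate.

  \<^emph>\<open>Geodesically stackable implies almost convex\<close> (\<open>almost_convex_if_geodesic_flow\<close>).  A maximal tree
  spans the Cayley graph, and since its normal forms are geodesic, each tree edge joins a vertex to
  its parent.  Sending each vertex to its ancestor in \<open>B(n)\<close> collapses the tree edges outside the
  ball.  Given two vertices of \<open>S(n)\<close> at distance at most 2, the flow function is applied at most
  twice to the edges of a shortest path between them, until all nontree edges lie inside \<open>B(n)\<close>; the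
  projection of the result is a path inside \<open>B(n)\<close> of bounded length.

  \<^emph>\<open>Almost convex implies geodesically stackable.\<close>  The shortlex normal forms are closed under
  prefixes and label the paths of a maximal tree (\<open>maximal_nf_tree\<close>, \<open>normal_forms_nf_tree\<close>).  Almost
  convexity yields for each nontree edge a path of bounded length between its endpoints whose nontree
  edges have smaller level (\<open>exists_short_detours\<close>).  Half the level is the height, so that any choice of such
  paths is a flow function as required; the least admissible label is chosen (\<open>geodesic_flow\<close>).

  \<^emph>\<open>Computability of this flow function.\<close>  Reading words as numerals with the digits \<open>1, \<dots>, q\<close>
  identifies words over a nonempty alphabet with natural numbers and the shortlex order with the
  usual order.  All predicates involved reduce to the word problem: the normal form is the
  representative with the least number, and admissibility is a finite conjunction of conditions on normal forms.

  The word problem is decided as follows (\<open>elt_eq_iff\<close>).  Consider colourings of the words of bounded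
  length that are compatible with right multiplication and with the finitely many
  relations of a length sufficient for the detours.  The partition into group elements is one of them.  Conversely, every such
  colouring identifies a word with its normal form (\<open>colour_nf\<close>): multiplying a normal form by a letter
  is replaced by following the detour of the corresponding edge, by induction on the level.  The
  edges of a detour start in the ball through the tail of the edge that it replaces, so that a linear
  bound on the numbers of the words is enough.  Hence two words represent the same element iff no colouring separates them,
  and as the colourings can be coded by natural numbers below a recursive bound, this is decidable.
\<close>

section \<open>Closure properties of recursive functions\<close>

lemma recursive_fun_cong:
  assumes "recursive_fun n f" "\<And>xs. length xs = n \<Longrightarrow> f xs = f' xs"
  shows "recursive_fun n f'"
  by (rule recursive_fun.ext[OF assms(1)]) (simp add: assms(2))

named_theorems rec_intros

lemma recursive_fun_Suc [rec_intros]: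
  assumes "recursive_fun n f" shows "recursive_fun n (\<lambda>xs. Suc (f xs))"
  using recursive_fun.comp[of "[f]" "\<lambda>xs. Suc (xs ! 0)" n] recursive_fun.succ assms by simp

lemma recursive_fun_const [rec_intros]: "recursive_fun n (\<lambda>xs. k)"
proof (induction k)
  case (Suc k)
  then show ?case by (rule recursive_fun_Suc)
qed (rule recursive_fun.zero)

lemma recursive_fun_nth [rec_intros]: "i < n \<Longrightarrow> recursive_fun n (\<lambda>xs. xs ! i)"
  by (rule recursive_fun.proj)

lemma recursive_fun_hd [rec_intros]: "recursive_fun (Suc n) hd"
proof (rule recursive_fun_cong[OF recursive_fun.proj[of 0]])
  show "xs ! 0 = hd xs" if "length xs = Suc n" for xs :: "nat list"
    using that by (cases xs) auto
qed simp

text \<open>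
  The argument list serves as an environment for de Bruijn indices: a new variable is put in front,
  and a function of the old variables reads the tail.
\<close>

lemma recursive_fun_tl:
  assumes "recursive_fun n f" shows "recursive_fun (Suc n) (\<lambda>ys. f (tl ys))"
proof -
  have "recursive_fun (Suc n) (\<lambda>ys. f (map (\<lambda>g. g ys) (map (\<lambda>i xs. xs ! Suc i) [0..<n])))"
    using assms by (intro recursive_fun.comp) (auto intro: recursive_fun.proj)
  then show ?thesis
  proof (rule recursive_fun_cong)
    fix ys :: "nat list" assume "length ys = Suc n"
    then have "map (\<lambda>i. ys ! Suc i) [0..<n] = tl ys"
      by (intro nth_equalityI) (auto simp: nth_tl)
    then show "f (map (\<lambda>g. g ys) (map (\<lambda>i xs. xs ! Suc i) [0..<n])) = f (tl ys)"
      by (simp add: comp_def)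
  qed
qed

lemmas recursive_fun_hd_tl [rec_intros] = recursive_fun_tl[OF recursive_fun_hd]

lemmas recursive_fun_nth_tl [rec_intros] = recursive_fun_tl[OF recursive_fun_nth]

lemmas recursive_fun_nth_tl_tl [rec_intros] = recursive_fun_tl[OF recursive_fun_nth_tl]

lemma recursive_fun_Cons:
  assumes "recursive_fun (Suc n) f" "recursive_fun n b"
  shows "recursive_fun n (\<lambda>xs. f (b xs # xs))"
proof -
  have "recursive_fun n (\<lambda>xs. f (map (\<lambda>g. g xs) (b # map (\<lambda>i xs. xs ! i) [0..<n])))"
    using assms by (intro recursive_fun.comp) (auto intro: recursive_fun.proj)
  then show ?thesis
  proof (rule recursive_fun_cong)
    fix xs :: "nat list" assume "length xs = n"
    then have "map (\<lambda>i. xs ! i) [0..<n] = xs"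
      using map_nth by blast
    then show "f (map (\<lambda>g. g xs) (b # map (\<lambda>i xs. xs ! i) [0..<n])) = f (b xs # xs)"
      by (simp add: comp_def)
  qed
qed

lemma recursive_fun_rec_nat:
  assumes "recursive_fun n f"
    and "recursive_fun (Suc (Suc n)) (\<lambda>ys. g (hd ys) (hd (tl ys)) (tl (tl ys)))"
    and "recursive_fun n b"
  shows "recursive_fun n (\<lambda>xs. rec_nat (f xs) (\<lambda>y v. g y v xs) (b xs))"
proof -
  have "recursive_fun (Suc n)
      (\<lambda>xs. rec_nat (f (tl xs)) (\<lambda>y v. g y v (tl xs)) (hd xs))"
    using recursive_fun.prim_rec[where f = f and n = n
        and g = "\<lambda>ys. g (hd ys) (hd (tl ys)) (tl (tl ys))"] assms(1,2)
    by (simp only: add_2_eq_Suc' add.commute[of n 1] plus_1_eq_Suc list.sel)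
  from recursive_fun_Cons[OF this assms(3)] show ?thesis by simp
qed

lemma recursive_fun_add [rec_intros]:
  assumes "recursive_fun n f" "recursive_fun n g"
  shows "recursive_fun n (\<lambda>xs. f xs + g xs)"
proof -
  have "rec_nat a (\<lambda>y v. Suc v) b = a + b" for a b :: nat
    by (induction b) auto
  moreover have "recursive_fun n (\<lambda>xs. rec_nat (f xs) (\<lambda>y v. Suc v) (g xs))"
    by (rule assms assms[THEN recursive_fun_tl] assms[THEN recursive_fun_tl, THEN recursive_fun_tl]
          recursive_fun_rec_nat rec_intros)+
  ultimately show ?thesis by simp
qed

lemma recursive_fun_mult [rec_intros]:
  assumes "recursive_fun n f" "recursive_fun n g"
  shows "recursive_fun n (\<lambda>xs. f xs * g xs)"
proof -
  have "rec_nat 0 (\<lambda>y v. v + a) b = a * b" for a b :: nat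
    by (induction b) auto
  moreover have "recursive_fun n (\<lambda>xs. rec_nat 0 (\<lambda>y v. v + f xs) (g xs))"
    by (rule assms assms[THEN recursive_fun_tl] assms[THEN recursive_fun_tl, THEN recursive_fun_tl]
          recursive_fun_rec_nat rec_intros)+
  ultimately show ?thesis by simp
qed

lemma recursive_fun_power [rec_intros]:
  assumes "recursive_fun n f" "recursive_fun n g"
  shows "recursive_fun n (\<lambda>xs. f xs ^ g xs)"
proof -
  have "rec_nat 1 (\<lambda>y v. v * a) b = a ^ b" for a b :: nat
    by (induction b) auto
  moreover have "recursive_fun n (\<lambda>xs. rec_nat 1 (\<lambda>y v. v * f xs) (g xs))"
    by (rule assms assms[THEN recursive_fun_tl] assms[THEN recursive_fun_tl, THEN recursive_fun_tl]
          recursive_fun_rec_nat rec_intros)+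
  ultimately show ?thesis by simp
qed

lemma recursive_fun_diff [rec_intros]:
  assumes "recursive_fun n f" "recursive_fun n g"
  shows "recursive_fun n (\<lambda>xs. f xs - g xs)"
proof -
  have pred: "recursive_fun k (\<lambda>xs. h xs - 1)" if "recursive_fun k h" for k h
  proof -
    have "rec_nat 0 (\<lambda>y v. y) b = b - 1" for b :: nat
      by (induction b) auto
    moreover have "recursive_fun k (\<lambda>xs. rec_nat 0 (\<lambda>y v. y) (h xs))"
      by (rule that recursive_fun_rec_nat rec_intros)+
    ultimately show ?thesis by simp
  qed
  have "rec_nat a (\<lambda>y v. v - 1) b = a - b" for a b :: nat
    by (induction b) auto
  moreover have "recursive_fun n (\<lambda>xs. rec_nat (f xs) (\<lambda>y v. v - 1) (g xs))"
    by (rule assms assms[THEN recursive_fun_tl] assms[THEN recursive_fun_tl, THEN recursive_fun_tl]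
          recursive_fun_rec_nat rec_intros pred)+
  ultimately show ?thesis by simp
qed

definition recursive_pred :: "nat \<Rightarrow> (nat list \<Rightarrow> bool) \<Rightarrow> bool" where
  "recursive_pred n P \<longleftrightarrow> recursive_fun n (\<lambda>xs. if P xs then 1 else 0)"

lemma recursive_pred_cong:
  assumes "recursive_pred n P" "\<And>xs. length xs = n \<Longrightarrow> P xs = P' xs"
  shows "recursive_pred n P'"
  unfolding recursive_pred_def
  by (rule recursive_fun_cong[OF assms(1)[unfolded recursive_pred_def]]) (simp add: assms(2))

lemma recursive_pred_const [rec_intros]: "recursive_pred n (\<lambda>xs. b)"
  unfolding recursive_pred_def by (rule recursive_fun_const)

lemma recursive_pred_not [rec_intros]:
  assumes "recursive_pred n P" shows "recursive_pred n (\<lambda>xs. \<not> P xs)"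
proof -
  have "recursive_fun n (\<lambda>xs. 1 - (if P xs then 1 else 0))"
    by (rule assms[unfolded recursive_pred_def] rec_intros)+
  then show ?thesis unfolding recursive_pred_def by (rule recursive_fun_cong) auto
qed

lemma recursive_pred_conj [rec_intros]:
  assumes "recursive_pred n P" "recursive_pred n Q"
  shows "recursive_pred n (\<lambda>xs. P xs \<and> Q xs)"
proof -
  have "recursive_fun n (\<lambda>xs. (if P xs then 1 else 0) * (if Q xs then 1 else 0))"
    by (rule assms[unfolded recursive_pred_def] rec_intros)+
  then show ?thesis unfolding recursive_pred_def by (rule recursive_fun_cong) auto
qed

lemma recursive_pred_disj [rec_intros]:
  assumes "recursive_pred n P" "recursive_pred n Q"
  shows "recursive_pred n (\<lambda>xs. P xs \<or> Q xs)"
proof -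
  have "recursive_pred n (\<lambda>xs. \<not> (\<not> P xs \<and> \<not> Q xs))"
    by (rule assms rec_intros)+
  then show ?thesis by (rule recursive_pred_cong) auto
qed

lemma recursive_pred_imp [rec_intros]:
  assumes "recursive_pred n P" "recursive_pred n Q"
  shows "recursive_pred n (\<lambda>xs. P xs \<longrightarrow> Q xs)"
proof -
  have "recursive_pred n (\<lambda>xs. \<not> P xs \<or> Q xs)"
    by (rule assms rec_intros)+
  then show ?thesis by (rule recursive_pred_cong) auto
qed

lemma recursive_pred_le [rec_intros]:
  assumes "recursive_fun n f" "recursive_fun n g"
  shows "recursive_pred n (\<lambda>xs. f xs \<le> g xs)"
proof -
  have "recursive_fun n (\<lambda>xs. 1 - (f xs - g xs))"
    by (rule assms rec_intros)+
  then show ?thesis unfolding recursive_pred_def by (rule recursive_fun_cong) auto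
qed

lemma recursive_pred_less [rec_intros]:
  assumes "recursive_fun n f" "recursive_fun n g"
  shows "recursive_pred n (\<lambda>xs. f xs < g xs)"
proof -
  have "recursive_pred n (\<lambda>xs. \<not> g xs \<le> f xs)"
    by (rule assms rec_intros)+
  then show ?thesis by (rule recursive_pred_cong) auto
qed

lemma recursive_pred_eq [rec_intros]:
  assumes "recursive_fun n f" "recursive_fun n g"
  shows "recursive_pred n (\<lambda>xs. f xs = g xs)"
proof -
  have "recursive_pred n (\<lambda>xs. f xs \<le> g xs \<and> g xs \<le> f xs)"
    by (rule assms rec_intros)+
  then show ?thesis by (rule recursive_pred_cong) auto
qed

lemma recursive_fun_if [rec_intros]:
  assumes "recursive_pred n P" "recursive_fun n f" "recursive_fun n g"
  shows "recursive_fun n (\<lambda>xs. if P xs then f xs else g xs)"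
proof -
  have "recursive_fun n (\<lambda>xs. (if P xs then 1 else 0) * f xs + (1 - (if P xs then 1 else 0)) * g xs)"
    by (rule assms(2,3) assms(1)[unfolded recursive_pred_def] rec_intros)+
  then show ?thesis by (rule recursive_fun_cong) auto
qed

text \<open>
  By primitive recursion on the bound.  The step function sees \<open>y\<close>, the accumulated truth value \<open>v\<close>
  and the environment; the bulk of the proof erases \<open>v\<close> from the arguments of \<open>P\<close>.
\<close>

lemma recursive_pred_all_less:
  assumes P: "recursive_pred (Suc n) (\<lambda>ys. P (hd ys) (tl ys))" and b: "recursive_fun n b"
  shows "recursive_pred n (\<lambda>xs. \<forall>y<b xs. P y xs)"
proof -
  have eq: "rec_nat 1 (\<lambda>y v. if P y xs then v else 0) k = (if \<forall>y<k. P y xs then 1 else 0)"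
    for xs and k :: nat
    by (induction k) (auto simp: less_Suc_eq)
  have "recursive_fun (Suc n) (\<lambda>zs. if P (hd zs) (tl zs) then 1 else 0)"
    using P unfolding recursive_pred_def .
  moreover have "recursive_fun (Suc (Suc n)) (\<lambda>ys. hd ys)"
    by (rule recursive_fun_hd)
  ultimately have "recursive_fun (Suc (Suc n)) (\<lambda>ys.
      (\<lambda>zs. if P (hd zs) (tl zs) then 1 else 0) (map (\<lambda>g. g ys) ((\<lambda>ys. hd ys) # map (\<lambda>i xs. xs ! Suc (Suc i)) [0..<n])))"
    by (intro recursive_fun.comp) (auto intro: recursive_fun.proj)
  then have "recursive_pred (Suc (Suc n)) (\<lambda>ys. P (hd ys) (tl (tl ys)))"
    unfolding recursive_pred_def
  proof (rule recursive_fun_cong)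
    fix ys :: "nat list" assume "length ys = Suc (Suc n)"
    then have "map (\<lambda>i. ys ! Suc (Suc i)) [0..<n] = tl (tl ys)"
      by (intro nth_equalityI) (auto simp: nth_tl)
    then show "(\<lambda>zs. if P (hd zs) (tl zs) then 1 else 0) (map (\<lambda>g. g ys) ((\<lambda>ys. hd ys) # map (\<lambda>i xs. xs ! Suc (Suc i)) [0..<n]))
      = (if P (hd ys) (tl (tl ys)) then 1 else (0::nat))"
      by (simp add: comp_def)
  qed
  then have "recursive_fun (Suc (Suc n)) (\<lambda>ys. if P (hd ys) (tl (tl ys)) then hd (tl ys) else 0)"
    by (intro recursive_fun_if recursive_fun_tl recursive_fun_hd recursive_fun_const)
  then have "recursive_fun n (\<lambda>xs. rec_nat 1 (\<lambda>y v. if P y xs then v else 0) (b xs))"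
    by (rule recursive_fun_rec_nat[OF recursive_fun_const _ b])
  then show ?thesis unfolding recursive_pred_def eq .
qed

lemma recursive_pred_ex_less:
  assumes "recursive_pred (Suc n) (\<lambda>ys. P (hd ys) (tl ys))" "recursive_fun n b"
  shows "recursive_pred n (\<lambda>xs. \<exists>y<b xs. P y xs)"
proof -
  have "recursive_pred n (\<lambda>xs. \<not> (\<forall>y<b xs. \<not> P y xs))"
    by (rule assms recursive_pred_all_less rec_intros)+
  then show ?thesis by (rule recursive_pred_cong) auto
qed

lemma recursive_fun_Least:
  assumes P: "recursive_pred (Suc n) (\<lambda>ys. P (hd ys) (tl ys))"
    and ex: "\<And>xs. length xs = n \<Longrightarrow> \<exists>y. P y xs"
  shows "recursive_fun n (\<lambda>xs. LEAST y. P y xs)"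
proof -
  have "recursive_fun (n + 1) (\<lambda>ys. if \<not> P (hd ys) (tl ys) then 1 else 0)"
    using recursive_pred_not[OF P] unfolding recursive_pred_def by simp
  then have "recursive_fun n (\<lambda>xs. LEAST y. (\<lambda>ys. if \<not> P (hd ys) (tl ys) then 1 else (0::nat)) (y # xs) = 0)"
    using ex by (intro recursive_fun.minim) auto
  moreover have "((\<lambda>ys. if \<not> P (hd ys) (tl ys) then 1 else (0::nat)) (y # xs) = 0) = P y xs" for y xs
    by simp
  ultimately show ?thesis by (simp only:)
qed

lemma recursive_pred_Ball:
  assumes "finite F" "\<And>t. t \<in> F \<Longrightarrow> recursive_pred n (P t)"
  shows "recursive_pred n (\<lambda>xs. \<forall>t\<in>F. P t xs)"
  using assms
proof (induction F)
  case (insert t F)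
  then show ?case by (simp add: recursive_pred_conj)
qed (simp add: recursive_pred_const)

lemma recursive_pred_Bex:
  assumes "finite F" "\<And>t. t \<in> F \<Longrightarrow> recursive_pred n (P t)"
  shows "recursive_pred n (\<lambda>xs. \<exists>t\<in>F. P t xs)"
  using assms
proof (induction F)
  case (insert t F)
  then show ?case by (simp add: recursive_pred_disj)
qed (simp add: recursive_pred_const)

lemma recursive_fun_div [rec_intros]:
  assumes "recursive_fun n f" "recursive_fun n g"
  shows "recursive_fun n (\<lambda>xs. f xs div g xs)"
proof -
  have eq: "(LEAST d. b = 0 \<or> a < Suc d * b) = a div b" for a b :: nat
  proof (rule Least_equality)
    show "b = 0 \<or> a < Suc (a div b) * b"
      using dividend_less_times_div[of b a] by (auto simp: algebra_simps)
    show "a div b \<le> d" if "b = 0 \<or> a < Suc d * b" for d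
      using that by (metis div_by_0 le0 less_Suc_eq_le less_mult_imp_div_less)
  qed
  \<comment> \<open>The case of divisor 0 is included so that the minimisation is regular.\<close>
  have "recursive_fun n (\<lambda>xs. LEAST d. g xs = 0 \<or> f xs < Suc d * g xs)"
  proof (rule recursive_fun_Least)
    show "recursive_pred (Suc n) (\<lambda>ys. g (tl ys) = 0 \<or> f (tl ys) < Suc (hd ys) * g (tl ys))"
      by (rule assms assms[THEN recursive_fun_tl] rec_intros)+
    show "\<exists>d. g xs = 0 \<or> f xs < Suc d * g xs" for xs
      by (cases "g xs") (auto intro!: exI[of _ "f xs"])
  qed
  then show ?thesis unfolding eq .
qed

lemma recursive_fun_mod [rec_intros]:
  assumes "recursive_fun n f" "recursive_fun n g"
  shows "recursive_fun n (\<lambda>xs. f xs mod g xs)"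
  unfolding minus_div_mult_eq_mod[symmetric] by (rule assms rec_intros)+

section \<open>Decoding lists and digits\<close>

definition code_hd :: "nat \<Rightarrow> nat" where
  "code_hd w = fst (prod_decode (w - 1))"

definition code_tl :: "nat \<Rightarrow> nat" where
  "code_tl w = snd (prod_decode (w - 1))"

lemma code_hd_tl [simp]:
  "code_hd (list_encode (d # ds)) = d" "code_tl (list_encode (d # ds)) = list_encode ds"
  by (auto simp: code_hd_def code_tl_def)

lemma recursive_fun_prod_encode [rec_intros]:
  assumes "recursive_fun n f" "recursive_fun n g"
  shows "recursive_fun n (\<lambda>xs. prod_encode (f xs, g xs))"
  unfolding prod_encode_def triangle_def prod.case by (rule assms rec_intros)+

lemma prod_encode_eq_code: "prod_encode (a, b) = w - 1 \<longleftrightarrow> a = code_hd w \<and> b = code_tl w"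
proof
  assume "prod_encode (a, b) = w - 1"
  then have "prod_decode (w - 1) = (a, b)" using prod_encode_inverse[of "(a, b)"] by simp
  then show "a = code_hd w \<and> b = code_tl w" by (simp add: code_hd_def code_tl_def)
qed (simp add: code_hd_def code_tl_def)

lemma recursive_fun_code_hd [rec_intros]:
  assumes "recursive_fun n f" shows "recursive_fun n (\<lambda>xs. code_hd (f xs))"
proof -
  have le: "code_tl w < Suc (w - 1)" for w
    using le_prod_encode_2[of "code_tl w" "code_hd w"] prod_encode_eq_code[of "code_hd w" "code_tl w" w]
    by simp
  have eq: "(\<exists>b<Suc (w - 1). prod_encode (a, b) = w - 1) \<longleftrightarrow> a = code_hd w" for a w
    using le[of w] unfolding prod_encode_eq_code by auto
  have "recursive_fun n (\<lambda>xs. LEAST a. \<exists>b<Suc (f xs - 1). prod_encode (a, b) = f xs - 1)"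
  proof (rule recursive_fun_Least)
    show "recursive_pred (Suc n) (\<lambda>ys. \<exists>b<Suc (f (tl ys) - 1). prod_encode (hd ys, b) = f (tl ys) - 1)"
      by (rule assms recursive_pred_ex_less assms[THEN recursive_fun_tl]
          assms[THEN recursive_fun_tl, THEN recursive_fun_tl] rec_intros)+
    show "\<exists>a. \<exists>b<Suc (f xs - 1). prod_encode (a, b) = f xs - 1" for xs
      unfolding eq by simp
  qed
  then show ?thesis unfolding eq by (simp add: Least_equality)
qed

lemma recursive_fun_code_tl [rec_intros]:
  assumes "recursive_fun n f" shows "recursive_fun n (\<lambda>xs. code_tl (f xs))"
proof -
  have eq: "prod_encode (code_hd w, b) = w - 1 \<longleftrightarrow> b = code_tl w" for b w
    unfolding prod_encode_eq_code by simp
  have "recursive_fun n (\<lambda>xs. LEAST b. prod_encode (code_hd (f xs), b) = f xs - 1)"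
  proof (rule recursive_fun_Least)
    show "recursive_pred (Suc n) (\<lambda>ys. prod_encode (code_hd (f (tl ys)), hd ys) = f (tl ys) - 1)"
      by (rule assms assms[THEN recursive_fun_tl] rec_intros)+
    show "\<exists>b. prod_encode (code_hd (f xs), b) = f xs - 1" for xs
      unfolding eq by simp
  qed
  then show ?thesis unfolding eq by (simp add: Least_equality)
qed

definition code_drop :: "nat \<Rightarrow> nat \<Rightarrow> nat" where
  "code_drop i w = rec_nat w (\<lambda>_ v. if v = 0 then 0 else code_tl v) i"

lemma code_drop_list_encode: "code_drop i (list_encode ds) = list_encode (drop i ds)"
proof (induction i)
  case (Suc i)
  have "drop (Suc i) ds = tl (drop i ds)"
    by (simp add: drop_Suc tl_drop)
  then show ?case using Suc by (cases "drop i ds") (simp_all add: code_drop_def del: list_encode.simps(2), simp)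
qed (simp add: code_drop_def)

lemma recursive_fun_code_drop [rec_intros]:
  assumes "recursive_fun n f" "recursive_fun n g"
  shows "recursive_fun n (\<lambda>xs. code_drop (f xs) (g xs))"
  unfolding code_drop_def
  by (rule assms assms[THEN recursive_fun_tl] assms[THEN recursive_fun_tl, THEN recursive_fun_tl]
        recursive_fun_rec_nat rec_intros)+

text \<open>
  Evaluation of the list coded by \<open>w\<close> at the base \<open>q\<close>, leading digit first.  The code of a list is
  at least its length, so that \<open>w\<close> rounds suffice.
\<close>

definition code_horner :: "nat \<Rightarrow> nat \<Rightarrow> nat" where
  "code_horner q w =
     rec_nat 0 (\<lambda>i v. if code_drop i w = 0 then v else v * q + code_hd (code_drop i w)) w"

lemma length_le_list_encode: "length ds \<le> list_encode ds"
proof (induction ds)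
  case (Cons d ds)
  then show ?case using le_prod_encode_2[of "list_encode ds" d] by simp
qed simp

lemma list_encode_drop_conv:
  "list_encode (drop i ds) = 0 \<longleftrightarrow> length ds \<le> i"
proof -
  have "list_encode xs = 0 \<longleftrightarrow> xs = []" for xs by (cases xs) auto
  then show ?thesis by simp
qed

lemma code_hd_code_drop:
  "i < length ds \<Longrightarrow> code_hd (code_drop i (list_encode ds)) = ds ! i"
  unfolding code_drop_list_encode
  by (subst Cons_nth_drop_Suc[symmetric]) (simp_all del: list_encode.simps)

lemma code_horner_list_encode:
  "code_horner q (list_encode ds) = foldl (\<lambda>v d. v * q + d) 0 ds"
proof -
  have "rec_nat 0 (\<lambda>i v. if code_drop i (list_encode ds) = 0 then v
        else v * q + code_hd (code_drop i (list_encode ds))) n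
      = foldl (\<lambda>v d. v * q + d) 0 (take n ds)" for n
  proof (induction n)
    case (Suc n)
    show ?case
    proof (cases "n < length ds")
      case True
      then show ?thesis using Suc
        by (simp add: code_hd_code_drop take_Suc_conv_app_nth)
           (simp add: code_drop_list_encode list_encode_drop_conv)
    next
      case False
      then show ?thesis using Suc by (simp add: code_drop_list_encode list_encode_drop_conv)
    qed
  qed simp
  then show ?thesis using length_le_list_encode[of ds] by (simp add: code_horner_def)
qed

lemma recursive_fun_code_horner [rec_intros]:
  assumes "recursive_fun n f"
  shows "recursive_fun n (\<lambda>xs. code_horner q (f xs))"
  unfolding code_horner_def
  by (rule assms assms[THEN recursive_fun_tl] assms[THEN recursive_fun_tl, THEN recursive_fun_tl]
        recursive_fun_rec_nat rec_intros)+

lemma list_encode_in_range_iff: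
  "w \<in> list_encode ` lists D \<longleftrightarrow>
     (\<forall>i<w. code_drop i w = 0 \<or> code_hd (code_drop i w) \<in> D)"
proof -
  define ds where "ds = list_decode w"
  then have w: "w = list_encode ds" by simp
  have "w \<in> list_encode ` lists D \<longleftrightarrow> ds \<in> lists D"
    unfolding w by (rule inj_image_mem_iff) (rule inj_list_encode)
  also have "\<dots> \<longleftrightarrow> (\<forall>i<length ds. ds ! i \<in> D)"
    unfolding in_lists_conv_set all_set_conv_all_nth ..
  also have "\<dots> \<longleftrightarrow> (\<forall>i<w. code_drop i w = 0 \<or> code_hd (code_drop i w) \<in> D)"
  proof -
    have "code_drop i w = 0 \<or> code_hd (code_drop i w) \<in> D \<longleftrightarrow> (i < length ds \<longrightarrow> ds ! i \<in> D)" for i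
      using code_hd_code_drop[of i ds] list_encode_drop_conv[of i ds]
      by (cases "i < length ds") (simp_all add: w code_drop_list_encode)
    then show ?thesis
      using length_le_list_encode[of ds] w by auto
  qed
  finally show ?thesis .
qed

definition digit :: "nat \<Rightarrow> nat \<Rightarrow> nat \<Rightarrow> nat" where
  "digit s B x = (s div B ^ x) mod B"

text \<open>
  Bounded functions on an initial segment of the natural numbers are coded by natural numbers, so
  that a quantifier over such functions becomes a bounded quantifier over codes.
\<close>

lemma exists_digits:
  assumes "\<And>x. x < n \<Longrightarrow> c x < B"
  shows "\<exists>s<B ^ n. \<forall>x<n. digit s B x = c x"
  using assms
proof (induction n)
  case (Suc n)
  then obtain s where s: "s < B ^ n" "\<And>x. x < n \<Longrightarrow> digit s B x = c x" by auto
  have c: "c n < B" using Suc.prems by simp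
  then have B: "0 < B" by simp
  let ?s = "s + c n * B ^ n"
  have "?s < B ^ n + c n * B ^ n" using s(1) by simp
  also have "\<dots> = Suc (c n) * B ^ n" by simp
  also have "\<dots> \<le> B * B ^ n" using c by (intro mult_le_mono1) simp
  finally have "?s < B ^ Suc n" by simp
  moreover have "digit ?s B x = c x" if "x < Suc n" for x
  proof (cases "x = n")
    case True
    then show ?thesis using s(1) c B by (simp add: digit_def)
  next
    case False
    then have x: "x < n" using that by simp
    then have "B ^ n = B ^ (n - x) * B ^ x" by (simp flip: power_add)
    then have "?s div B ^ x = s div B ^ x + c n * B ^ (n - x)" using B by (simp add: mult.assoc[symmetric])
    moreover have "B dvd c n * B ^ (n - x)" using x by (intro dvd_mult dvd_power) auto
    ultimately show ?thesis using s(2)[OF x] Suc.prems[OF that] by (simp add: digit_def mod_add_eq[symmetric] dvd_imp_mod_0)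
  qed
  ultimately show ?case by blast
qed simp

lemma recursive_fun_digit [rec_intros]:
  assumes "recursive_fun n f" "recursive_fun n g" "recursive_fun n h"
  shows "recursive_fun n (\<lambda>xs. digit (f xs) (g xs) (h xs))"
  unfolding digit_def by (rule assms rec_intros)+

lemma recursive_pred_comp2:
  assumes "recursive_pred 2 (\<lambda>xs. P (xs ! 0) (xs ! 1))" "recursive_fun n f" "recursive_fun n g"
  shows "recursive_pred n (\<lambda>xs. P (f xs) (g xs))"
proof -
  have "recursive_fun n (\<lambda>xs. (\<lambda>zs. if P (zs ! 0) (zs ! 1) then 1 else 0) (map (\<lambda>h. h xs) [f, g]))"
    using assms unfolding recursive_pred_def
    by (intro recursive_fun.comp) (simp_all add: numeral_2_eq_2)
  then show ?thesis unfolding recursive_pred_def by simp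
qed

section \<open>Words and walks in the Cayley graph\<close>

locale symmetric_generators = group G for G :: "('a, 'b) monoid_scheme" (structure) +
  fixes A :: "'a set"
  assumes finite_A: "finite A"
    and A_subset: "A \<subseteq> carrier G"
    and generate_A: "generate G A = carrier G"
    and inv_A: "a \<in> A \<Longrightarrow> inv a \<in> A"
    and one_notin_A: "\<one> \<notin> A"
begin

abbreviation val :: "'a list \<Rightarrow> 'a" where "val \<equiv> word_val G"

abbreviation \<Gamma> :: "('a, 'a \<times> 'a) pre_digraph" where "\<Gamma> \<equiv> cayley G A"

abbreviation norm :: "'a \<Rightarrow> nat" where "norm g \<equiv> cayley_dist G A \<one> g"

text \<open>Twice the height of an edge.\<close>

definition level :: "'a \<times> 'a \<Rightarrow> nat" where
  "level e = norm (fst e) + norm (fst e \<otimes> snd e)"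

lemma A_carrier [simp]: "a \<in> A \<Longrightarrow> a \<in> carrier G"
  using A_subset by blast

lemma val_Nil [simp]: "val [] = \<one>"
  and val_Cons [simp]: "val (a # w) = a \<otimes> val w"
  by (auto simp: word_val_def)

lemma val_closed [simp]: "w \<in> lists A \<Longrightarrow> val w \<in> carrier G"
  by (induction w) auto

lemma val_append [simp]:
  "u \<in> lists A \<Longrightarrow> v \<in> lists A \<Longrightarrow> val (u @ v) = val u \<otimes> val v"
  by (induction u) (auto simp: m_assoc)

lemma exists_word:
  assumes "g \<in> carrier G" shows "\<exists>w\<in>lists A. val w = g"
proof -
  have "g \<in> generate G A" using assms generate_A by simp
  then show ?thesis
  proof induction
    case one
    then show ?case by (intro bexI[of _ "[]"]) auto
  next
    case (incl h)
    then show ?case by (intro bexI[of _ "[h]"]) auto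
  next
    case (inv h)
    then show ?case using inv_A by (intro bexI[of _ "[inv h]"]) auto
  next
    case (eng h1 h2)
    then obtain w1 w2 where "w1 \<in> lists A" "val w1 = h1" "w2 \<in> lists A" "val w2 = h2"
      by blast
    then show ?case by (intro bexI[of _ "w1 @ w2"]) auto
  qed
qed

primrec walk :: "'a \<Rightarrow> 'a list \<Rightarrow> ('a \<times> 'a) list" where
  "walk g [] = []"
| "walk g (a # w) = (g, a) # walk (g \<otimes> a) w"

lemma path_label_walk [simp]: "path_label (walk g w) = w"
  by (induction w arbitrary: g) (auto simp: path_label_def)

lemma length_walk [simp]: "length (walk g w) = length w"
  by (induction w arbitrary: g) auto

lemma walk_append:
  "g \<in> carrier G \<Longrightarrow> u \<in> lists A \<Longrightarrow> walk g (u @ v) = walk g u @ walk (g \<otimes> val u) v"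
  by (induction u arbitrary: g) (auto simp: m_assoc)

lemma cayley_simps [simp]:
  "verts \<Gamma> = carrier G" "arcs \<Gamma> = carrier G \<times> A" "tail \<Gamma> = fst"
  "head \<Gamma> e = fst e \<otimes> snd e"
  by (auto simp: cayley_def)

lemma wf_cayley: "wf_digraph \<Gamma>"
  by standard auto

lemma nth_walk:
  "g \<in> carrier G \<Longrightarrow> w \<in> lists A \<Longrightarrow> i < length w \<Longrightarrow> walk g w ! i = (g \<otimes> val (take i w), w ! i)"
proof (induction w arbitrary: g i)
  case (Cons a w)
  then have "take j w \<in> lists A" for j
    by (meson in_set_takeD in_listsD in_listsI listsE)
  then show ?case using Cons by (cases i) (auto simp: m_assoc)
qed simp

lemma awalk_cayley_iff:
  "pre_digraph.awalk \<Gamma> u p v \<longleftrightarrow>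
     u \<in> carrier G \<and> (\<exists>w\<in>lists A. p = walk u w \<and> v = u \<otimes> val w)"
proof (induction p arbitrary: u)
  case Nil
  have "[] = walk u w \<longleftrightarrow> w = []" for w by (cases w) auto
  then show ?case
    by (simp add: wf_digraph.awalk_Nil_iff[OF wf_cayley] eq_commute[of v] conj_commute cong: conj_cong)
next
  case (Cons e p)
  have "pre_digraph.awalk \<Gamma> u (e # p) v \<longleftrightarrow>
      u \<in> carrier G \<and> fst e = u \<and> snd e \<in> A \<and> pre_digraph.awalk \<Gamma> (u \<otimes> snd e) p v"
    using wf_digraph.awalk_Cons_iff[OF wf_cayley, of u e p v] by (cases e) auto
  also have "\<dots> \<longleftrightarrow> u \<in> carrier G \<and> fst e = u \<and> snd e \<in> A \<and>
      (\<exists>w\<in>lists A. p = walk (u \<otimes> snd e) w \<and> v = u \<otimes> val (snd e # w))"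
  proof -
    have "(\<exists>w\<in>lists A. p = walk (u \<otimes> snd e) w \<and> v = u \<otimes> snd e \<otimes> val w) \<longleftrightarrow>
        (\<exists>w\<in>lists A. p = walk (u \<otimes> snd e) w \<and> v = u \<otimes> val (snd e # w))"
      if "u \<in> carrier G" "snd e \<in> A"
      using that by (intro bex_cong) (simp_all add: m_assoc)
    then show ?thesis unfolding Cons.IH by auto
  qed
  also have "\<dots> \<longleftrightarrow> u \<in> carrier G \<and> (\<exists>w\<in>lists A. e # p = walk u w \<and> v = u \<otimes> val w)"
    (is "?L \<longleftrightarrow> ?R")
  proof
    assume ?L
    then obtain w where "u \<in> carrier G" "fst e = u" "snd e \<in> A" "w \<in> lists A"
      "p = walk (u \<otimes> snd e) w" "v = u \<otimes> val (snd e # w)" by blast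
    then show ?R by (intro conjI bexI[of _ "snd e # w"]) auto
  next
    assume ?R
    then obtain w where w: "u \<in> carrier G" "w \<in> lists A" "e # p = walk u w" "v = u \<otimes> val w"
      by blast
    then obtain a w' where "w = a # w'" by (cases w) auto
    then show ?L using w by auto
  qed
  finally show ?case .
qed

lemma awalk_walk: "u \<in> carrier G \<Longrightarrow> w \<in> lists A \<Longrightarrow> pre_digraph.awalk \<Gamma> u (walk u w) (u \<otimes> val w)"
  unfolding awalk_cayley_iff by blast

lemma cayley_dist_le:
  "u \<in> carrier G \<Longrightarrow> w \<in> lists A \<Longrightarrow> cayley_dist G A u (u \<otimes> val w) \<le> length w"
  unfolding cayley_dist_def using awalk_walk[of u w]
  by (intro Least_le exI[of _ "walk u w"]) simp

lemma cayley_dist_attained: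
  assumes "u \<in> carrier G" "v \<in> carrier G"
  shows "\<exists>w\<in>lists A. u \<otimes> val w = v \<and> length w = cayley_dist G A u v"
proof -
  obtain w where w: "w \<in> lists A" "val w = inv u \<otimes> v"
    using exists_word[of "inv u \<otimes> v"] assms by auto
  then have "u \<otimes> val w = v" using assms by (simp add: m_assoc[symmetric])
  then have "\<exists>p. pre_digraph.awalk \<Gamma> u p v \<and> length p = length w"
    using awalk_walk[OF assms(1) w(1)] by (intro exI[of _ "walk u w"]) simp
  then have "\<exists>p. pre_digraph.awalk \<Gamma> u p v \<and> length p = cayley_dist G A u v"
    unfolding cayley_dist_def by (rule LeastI)
  then show ?thesis unfolding awalk_cayley_iff by auto
qed

lemma norm_le: "w \<in> lists A \<Longrightarrow> norm (val w) \<le> length w"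
  using cayley_dist_le[of \<one> w] by simp

lemma norm_attained:
  "g \<in> carrier G \<Longrightarrow> \<exists>w\<in>lists A. val w = g \<and> length w = norm g"
  using cayley_dist_attained[of \<one> g] by (simp cong: conj_cong bex_cong)

lemma norm_one [simp]: "norm \<one> = 0"
  using norm_le[of "[]"] by simp

lemma mult_inv_cancel [simp]:
  "g \<in> carrier G \<Longrightarrow> a \<in> A \<Longrightarrow> g \<otimes> a \<otimes> inv a = g"
  "g \<in> carrier G \<Longrightarrow> a \<in> A \<Longrightarrow> g \<otimes> inv a \<otimes> a = g"
  by (simp_all add: m_assoc)

lemma norm_mult_le:
  assumes "g \<in> carrier G" "a \<in> A" shows "norm (g \<otimes> a) \<le> Suc (norm g)"
proof -
  obtain w where "w \<in> lists A" "val w = g" "length w = norm g"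
    using norm_attained assms by blast
  then show ?thesis using norm_le[of "w @ [a]"] assms by simp
qed

lemma norm_le_mult:
  assumes "g \<in> carrier G" "a \<in> A" shows "norm g \<le> Suc (norm (g \<otimes> a))"
  using norm_mult_le[of "g \<otimes> a" "inv a"] assms inv_A by simp

lemma edge_height_eq: "edge_height G A e = real (level e) / 2"
  by (simp add: edge_height_def level_def)

text \<open>
  The norms of the endpoints of an edge differ by at most one.  Hence an edge lies in \<open>B(n)\<close> iff
  its midpoint does.
\<close>

lemma inside_ball_iff:
  assumes "set p \<subseteq> carrier G \<times> A"
  shows "inside_ball G A n u p \<longleftrightarrow> norm u \<le> n \<and> (\<forall>e\<in>set p. level e < 2 * n)"
proof -
  have "(\<forall>t\<in>{0..1}. point_dist G A e t \<le> real n) \<longleftrightarrow> level e < 2 * n" if "e \<in> carrier G \<times> A" for e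
  proof -
    obtain g a where e: "e = (g, a)" "g \<in> carrier G" "a \<in> A"
      using \<open>e \<in> carrier G \<times> A\<close> by (cases e) auto
    have d: "norm (g \<otimes> a) \<le> Suc (norm g)" "norm g \<le> Suc (norm (g \<otimes> a))"
      using e norm_mult_le norm_le_mult by auto
    show ?thesis
    proof
      assume "\<forall>t\<in>{0..1}. point_dist G A e t \<le> real n"
      then have "point_dist G A e (1/2) \<le> real n" by simp
      then have "min (real (norm g)) (real (norm (g \<otimes> a))) + 1/2 \<le> real n"
        by (simp add: point_dist_def e min_def split: if_splits)
      then have "real (min (norm g) (norm (g \<otimes> a))) + 1/2 \<le> real n"
        by (simp add: of_nat_min)
      then have "min (norm g) (norm (g \<otimes> a)) < n"
        by linarith
      then show "level e < 2 * n" using d by (auto simp: level_def e)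
    next
      assume "level e < 2 * n"
      then have "norm g + norm (g \<otimes> a) < 2 * n" by (simp add: level_def e)
      then have "norm g < n \<or> norm (g \<otimes> a) < n" by linarith
      then show "\<forall>t\<in>{0..1}. point_dist G A e t \<le> real n"
      proof
        assume "norm g < n"
        then have "real (norm g) + 1 \<le> real n" by linarith
        then show ?thesis by (auto simp: point_dist_def e min_le_iff_disj)
      next
        assume "norm (g \<otimes> a) < n"
        then have "real (norm (g \<otimes> a)) + 1 \<le> real n" by linarith
        then show ?thesis by (auto simp: point_dist_def e min_le_iff_disj)
      qed
    qed
  qed
  then show ?thesis using assms unfolding inside_ball_def by blast
qed

lemma set_walk_subset:
  "g \<in> carrier G \<Longrightarrow> w \<in> lists A \<Longrightarrow> set (walk g w) \<subseteq> carrier G \<times> A"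
  by (induction w arbitrary: g) auto

lemma almost_convex_iff:
  "almost_convex G A \<longleftrightarrow>
     (\<exists>k. \<forall>g\<in>carrier G. \<forall>h\<in>carrier G. norm h = norm g \<and> cayley_dist G A g h \<le> 2 \<longrightarrow>
        (\<exists>w\<in>lists A. g \<otimes> val w = h \<and> length w \<le> k \<and> (\<forall>e\<in>set (walk g w). level e < 2 * norm g)))"
proof -
  have "(\<exists>p. pre_digraph.awalk \<Gamma> g p h \<and> inside_ball G A (norm g) g p \<and> length p \<le> k) \<longleftrightarrow>
      (\<exists>w\<in>lists A. g \<otimes> val w = h \<and> length w \<le> k \<and> (\<forall>e\<in>set (walk g w). level e < 2 * norm g))"
    if "g \<in> carrier G" for g h k
  proof -
    have "(\<exists>p. pre_digraph.awalk \<Gamma> g p h \<and> inside_ball G A (norm g) g p \<and> length p \<le> k) \<longleftrightarrow>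
      (\<exists>w\<in>lists A. h = g \<otimes> val w \<and> inside_ball G A (norm g) g (walk g w) \<and> length (walk g w) \<le> k)"
      unfolding awalk_cayley_iff using that by blast
    also have "\<dots> \<longleftrightarrow>
      (\<exists>w\<in>lists A. g \<otimes> val w = h \<and> length w \<le> k \<and> (\<forall>e\<in>set (walk g w). level e < 2 * norm g))"
      by (intro bex_cong) (auto simp: inside_ball_iff[OF set_walk_subset[OF that]])
    finally show ?thesis .
  qed
  then have "almost_convex G A \<longleftrightarrow> (\<exists>k. \<forall>n. \<forall>g\<in>sphere_vertices G A n. \<forall>h\<in>sphere_vertices G A n.
      cayley_dist G A g h \<le> 2 \<longrightarrow>
      (\<exists>w\<in>lists A. g \<otimes> val w = h \<and> length w \<le> k \<and> (\<forall>e\<in>set (walk g w). level e < 2 * norm g)))"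
    unfolding almost_convex_def sphere_vertices_def by simp
  then show ?thesis unfolding sphere_vertices_def by (simp add: Ball_def imp_conjL)
qed

section \<open>Trees in the Cayley graph\<close>

lemma take_lists [simp]: "w \<in> lists A \<Longrightarrow> take i w \<in> lists A"
  using set_take_subset[of i w] by (auto simp: in_lists_conv_set)

lemma nth_in_A: "w \<in> lists A \<Longrightarrow> i < length w \<Longrightarrow> w ! i \<in> A"
  using nth_mem by fastforce

lemma val_take_Suc:
  assumes "w \<in> lists A" "i < length w"
  shows "val (take (Suc i) w) = val (take i w) \<otimes> w ! i"
  using assms nth_in_A[OF assms] val_append[OF take_lists[OF assms(1)], of "[w ! i]" i]
  by (simp add: take_Suc_conv_app_nth)

lemma mult_val_take_Suc:
  assumes "u \<in> carrier G" "w \<in> lists A" "i < length w"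
  shows "u \<otimes> val (take (Suc i) w) = u \<otimes> val (take i w) \<otimes> w ! i"
  using val_take_Suc[OF assms(2,3)] nth_in_A[OF assms(2,3)] assms(1)
    val_closed[OF take_lists[OF assms(2)], of i]
  by (simp add: m_assoc)

lemma edge_eq_iff:
  assumes "g \<in> carrier G" "a \<in> A" "b \<in> A"
  shows "g \<otimes> a \<otimes> b = g \<longleftrightarrow> b = inv a"
proof
  assume "g \<otimes> a \<otimes> b = g"
  then have "a \<otimes> b = \<one>" using assms l_cancel_one[of g "a \<otimes> b"] by (simp add: m_assoc)
  then show "b = inv a" using assms inv_unique' by (metis A_carrier inv_equality inv_inv)
qed (use assms in simp)

context
  fixes T :: "('a, 'a \<times> 'a) pre_digraph"
  assumes T: "subgraph T \<Gamma>"
begin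

lemma subgraph_simps:
  shows "wf_digraph T" "tail T = fst" "head T e = fst e \<otimes> snd e"
    and "verts T \<subseteq> carrier G" "arcs T \<subseteq> carrier G \<times> A"
  using T cayley_simps(4)[of e] by (auto simp: subgraph_def compatible_def)

lemma arc_ends_in_verts: "(g, a) \<in> arcs T \<Longrightarrow> g \<in> verts T \<and> g \<otimes> a \<in> verts T"
  using wf_digraph.wellformed[OF subgraph_simps(1), of "(g, a)"] by (simp add: subgraph_simps)

lemma awalk_subgraph_iff:
  "pre_digraph.awalk T u p v \<longleftrightarrow>
     u \<in> verts T \<and> (\<exists>w\<in>lists A. p = walk u w \<and> set p \<subseteq> arcs T \<and> v = u \<otimes> val w)"
proof -
  have "pre_digraph.cas T = pre_digraph.cas \<Gamma>"
    using T compatible_cas by (metis subgraph_def)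
  then have "pre_digraph.awalk T u p v \<longleftrightarrow> u \<in> verts T \<and> set p \<subseteq> arcs T \<and> pre_digraph.awalk \<Gamma> u p v"
    using subgraph_simps(4,5) by (auto simp: pre_digraph.awalk_def)
  then show ?thesis unfolding awalk_cayley_iff using subgraph_simps(4) by blast
qed

lemma reachable_subgraph_iff:
  "u \<rightarrow>\<^sup>*\<^bsub>T\<^esub> v \<longleftrightarrow> u \<in> verts T \<and> (\<exists>w\<in>lists A. set (walk u w) \<subseteq> arcs T \<and> v = u \<otimes> val w)"
  unfolding wf_digraph.reachable_awalk[OF subgraph_simps(1)] awalk_subgraph_iff by blast

lemma cycle_subgraph_iff:
  "pre_digraph.cycle T p \<longleftrightarrow>
     (\<exists>u\<in>verts T. \<exists>w\<in>lists A. p = walk u w \<and> set p \<subseteq> arcs T \<and> u \<otimes> val w = u \<and> w \<noteq> [] \<and>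
        inj_on (\<lambda>i. u \<otimes> val (take (Suc i) w)) {..<length w})"
proof -
  have *: "distinct (tl (pre_digraph.awalk_verts T u (walk u w))) \<longleftrightarrow>
      inj_on (\<lambda>i. u \<otimes> val (take (Suc i) w)) {..<length w}"
    if "pre_digraph.awalk T u (walk u w) v" "w \<noteq> []" "u \<in> verts T" "w \<in> lists A" for u v w
  proof -
    have u: "u \<in> carrier G" using that subgraph_simps(4) by blast
    have "pre_digraph.cas T u (walk u w) v"
      using that by (simp add: pre_digraph.awalk_def)
    moreover have "walk u w \<noteq> []" using \<open>w \<noteq> []\<close> by (cases w) auto
    ultimately have "tl (pre_digraph.awalk_verts T u (walk u w)) = map (head T) (walk u w)"
      using pre_digraph.awalk_verts_conv' by force
    also have "\<dots> = map (\<lambda>i. u \<otimes> val (take (Suc i) w)) [0..<length w]"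
    proof (rule nth_equalityI)
      fix i assume "i < length (map (head T) (walk u w))"
      then show "map (head T) (walk u w) ! i = map (\<lambda>i. u \<otimes> val (take (Suc i) w)) [0..<length w] ! i"
        using that u by (simp add: nth_walk subgraph_simps mult_val_take_Suc)
    qed simp
    finally show ?thesis by (simp add: distinct_map lessThan_atLeast0)
  qed
  show ?thesis
  proof
    assume "pre_digraph.cycle T p"
    then obtain u where u: "pre_digraph.awalk T u p u" "p \<noteq> []"
      "distinct (tl (pre_digraph.awalk_verts T u p))"
      unfolding pre_digraph.cycle_def by blast
    then obtain w where w: "u \<in> verts T" "w \<in> lists A" "p = walk u w" "set p \<subseteq> arcs T" "u = u \<otimes> val w"
      unfolding awalk_subgraph_iff by blast
    moreover have "w \<noteq> []" using u w by auto
    ultimately show "\<exists>u\<in>verts T. \<exists>w\<in>lists A. p = walk u w \<and> set p \<subseteq> arcs T \<and> u \<otimes> val w = u \<and> w \<noteq> [] \<and>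
        inj_on (\<lambda>i. u \<otimes> val (take (Suc i) w)) {..<length w}"
      using u * by (intro bexI[of _ u] bexI[of _ w]) auto
  next
    assume "\<exists>u\<in>verts T. \<exists>w\<in>lists A. p = walk u w \<and> set p \<subseteq> arcs T \<and> u \<otimes> val w = u \<and> w \<noteq> [] \<and>
        inj_on (\<lambda>i. u \<otimes> val (take (Suc i) w)) {..<length w}"
    then obtain u w where w: "u \<in> verts T" "w \<in> lists A" "p = walk u w" "set p \<subseteq> arcs T"
      "u = u \<otimes> val w" "w \<noteq> []" "inj_on (\<lambda>i. u \<otimes> val (take (Suc i) w)) {..<length w}"
      by metis
    then have "pre_digraph.awalk T u p u" unfolding awalk_subgraph_iff by blast
    moreover have "p \<noteq> []" using w by (cases w) auto
    ultimately show "pre_digraph.cycle T p"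
      unfolding pre_digraph.cycle_def using * w by blast
  qed
qed

lemma symmetric_subgraph_iff:
  "symmetric T \<longleftrightarrow> (\<forall>g a. (g, a) \<in> arcs T \<longrightarrow> (g \<otimes> a, inv a) \<in> arcs T)"
proof -
  have "(\<exists>e'\<in>arcs T. fst e' = g \<otimes> a \<and> g = fst e' \<otimes> snd e') \<longleftrightarrow> (g \<otimes> a, inv a) \<in> arcs T"
    if "(g, a) \<in> arcs T" for g a
  proof
    assume "\<exists>e'\<in>arcs T. fst e' = g \<otimes> a \<and> g = fst e' \<otimes> snd e'"
    then obtain b where b: "(g \<otimes> a, b) \<in> arcs T" "g \<otimes> a \<otimes> b = g" by force
    then have "g \<in> carrier G" "a \<in> A" "b \<in> A" using that subgraph_simps(5) by auto
    then show "(g \<otimes> a, inv a) \<in> arcs T" using b edge_eq_iff by simp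
  next
    assume *: "(g \<otimes> a, inv a) \<in> arcs T"
    have "g \<in> carrier G" "a \<in> A" using that subgraph_simps(5) by auto
    then show "\<exists>e'\<in>arcs T. fst e' = g \<otimes> a \<and> g = fst e' \<otimes> snd e'"
      using * by (intro bexI[of _ "(g \<otimes> a, inv a)"]) auto
  qed
  then have "(\<forall>e\<in>arcs T. \<exists>e'\<in>arcs T. fst e = fst e' \<otimes> snd e' \<and> fst e \<otimes> snd e = fst e') \<longleftrightarrow>
     (\<forall>g a. (g, a) \<in> arcs T \<longrightarrow> (g \<otimes> a, inv a) \<in> arcs T)"
    by (auto simp: split_paired_Ball_Sigma eq_commute conj_commute Ball_def)
  then show ?thesis unfolding symmetric_conv subgraph_simps .
qed

end

lemma exit_edge:
  assumes "x \<in> S" "x \<in> carrier G" "w \<in> lists A" "x \<otimes> val w \<notin> S"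
  shows "\<exists>g\<in>S \<inter> carrier G. \<exists>a\<in>A. g \<otimes> a \<notin> S"
  using assms
proof (induction w arbitrary: x)
  case (Cons a w)
  show ?case
  proof (cases "x \<otimes> a \<in> S")
    case True
    then show ?thesis using Cons.prems by (intro Cons.IH[of "x \<otimes> a"]) (auto simp: m_assoc)
  qed (use Cons.prems in auto)
qed simp

text \<open>
  A cycle of length at least 3 does not backtrack: the two neighbours on the cycle of each of its
  vertices are distinct.
\<close>

lemma long_cycle_neighbours:
  assumes T: "subgraph T \<Gamma>" "symmetric T" and p: "pre_digraph.cycle T p" "3 \<le> length p"
    and x: "x \<in> fst ` set p"
  shows "\<exists>a b. a \<noteq> b \<and> (x, a) \<in> arcs T \<and> (x, b) \<in> arcs T \<and>
      x \<otimes> a \<in> fst ` set p \<and> x \<otimes> b \<in> fst ` set p \<and> (\<forall>c. (x, c) \<in> set p \<longrightarrow> c = a)"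
proof -
  obtain u w where uw: "u \<in> verts T" "w \<in> lists A" "p = walk u w" "set p \<subseteq> arcs T"
    "u \<otimes> val w = u" and inj: "inj_on (\<lambda>i. u \<otimes> val (take (Suc i) w)) {..<length w}"
    using p(1) unfolding cycle_subgraph_iff[OF T(1)] by blast
  have n: "3 \<le> length w" using uw p(2) by simp
  have u: "u \<in> carrier G" using uw subgraph_simps(4)[OF T(1)] by blast
  define P where "P i = u \<otimes> val (take i w)" for i
  have P_ends: "P 0 = u" "P (length w) = u" using uw u by (auto simp: P_def)
  have P_closed: "P i \<in> carrier G" for i
    using u uw(2) take_lists[of w i] val_closed by (simp add: P_def)
  have p_nth: "p ! i = (P i, w ! i)" "(P i, w ! i) \<in> arcs T" "P i \<in> fst ` set p" "P (Suc i) = P i \<otimes> w ! i"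
    if "i < length w" for i
  proof -
    show *: "p ! i = (P i, w ! i)" using that uw u by (simp add: nth_walk P_def)
    have "p ! i \<in> set p" using that uw(3) by simp
    then show "(P i, w ! i) \<in> arcs T" "P i \<in> fst ` set p" using * uw(4) by force+
    show "P (Suc i) = P i \<otimes> w ! i" using that uw u by (simp add: P_def mult_val_take_Suc)
  qed
  have P_inj: "P i = P j \<Longrightarrow> i = j" if "0 < i" "i \<le> length w" "0 < j" "j \<le> length w" for i j
    using inj_onD[OF inj, of "i - 1" "j - 1"] that by (cases i; cases j) (auto simp: P_def)
  obtain e where "e \<in> set p" "x = fst e" using x by blast
  then obtain i where i: "i < length w" "P i = x"
    using p_nth(1) uw(3) by (metis fst_conv in_set_conv_nth length_walk)
  \<comment> \<open>The arc number \<open>j\<close> precedes the arc number \<open>i\<close> on the cycle.\<close>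
  define j where "j = (if i = 0 then length w else i) - 1"
  have j: "j < length w" using i n by (auto simp: j_def)
  have "P (Suc j) = x" using i P_ends n by (auto simp: j_def Suc_diff_le)
  then have "x = P j \<otimes> w ! j" using p_nth[OF j] by simp
  moreover have "w ! j \<in> A" using nth_in_A uw(2) j by blast
  ultimately have prev: "x \<otimes> inv (w ! j) = P j" "(x, inv (w ! j)) \<in> arcs T"
    using P_closed[of j] p_nth(2)[OF j] T(2) symmetric_subgraph_iff[OF T(1)] by auto
  have step: "x \<otimes> w ! i = P (Suc i)" using i p_nth by simp
  have "P (Suc i) \<noteq> P j"
  proof
    assume eq: "P (Suc i) = P j"
    define j' where "j' = (if j = 0 then length w else j)"
    have "P (Suc i) = P j'" using eq P_ends by (auto simp: j'_def)
    then have "Suc i = j'" using i j n by (intro P_inj) (auto simp: j'_def)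
    then show False using i n by (auto simp: j'_def j_def split: if_splits)
  qed
  moreover have "P (Suc i) \<in> fst ` set p"
  proof (cases "Suc i < length w")
    case False
    then have "Suc i = length w" using i by linarith
    then have "P (Suc i) = P 0" using P_ends by simp
    moreover have "0 < length w" using n by linarith
    ultimately show ?thesis using p_nth(3)[of 0] by simp
  qed (use p_nth(3) in blast)
  moreover have "c = w ! i" if "(x, c) \<in> set p" for c
  proof -
    obtain l where l: "l < length w" "P l = x" "w ! l = c"
      using \<open>(x, c) \<in> set p\<close> p_nth(1) uw(3) by (metis Pair_inject in_set_conv_nth length_walk)
    define i' l' where "i' = (if i = 0 then length w else i)" and "l' = (if l = 0 then length w else l)"
    have "P i' = P l'" using i l P_ends by (auto simp: i'_def l'_def)
    then have "i' = l'" using i l n by (intro P_inj) (auto simp: i'_def l'_def)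
    then show ?thesis using i l by (auto simp: i'_def l'_def split: if_splits)
  qed
  moreover have "(x, w ! i) \<in> arcs T" using p_nth(2) i by blast
  moreover have "P j \<in> fst ` set p" using p_nth(3) j by blast
  moreover have "w ! i \<noteq> inv (w ! j)" using \<open>P (Suc i) \<noteq> P j\<close> step prev(1) by auto
  ultimately show ?thesis
    using prev step by (intro exI[of _ "w ! i"] exI[of _ "inv (w ! j)"]) simp
qed

text \<open>
  A maximal tree spans the graph: an edge leaving the tree could be added as a leaf.  A cycle of
  length at least 3 does not pass through the leaf, since it would have to backtrack there.
\<close>

lemma maximal_tree_spanning:
  assumes "maximal_tree G A T" shows "verts T = carrier G"
proof (rule ccontr)
  assume not_spanning: "verts T \<noteq> carrier G"
  have T: "subgraph T \<Gamma>" and "symmetric T" and "strongly_connected T"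
    and acyclic: "\<And>p. pre_digraph.cycle T p \<Longrightarrow> length p < 3"
    and maximal: "\<And>T'. T' \<noteq> T \<Longrightarrow> subgraph T T' \<Longrightarrow> subgraph T' \<Gamma> \<Longrightarrow> \<not> undirected_tree T'"
    using assms by (auto simp: maximal_tree_def pre_digraph.max_subgraph_def undirected_tree_def not_le)
  have sym: "(g, a) \<in> arcs T \<Longrightarrow> (g \<otimes> a, inv a) \<in> arcs T" for g a
    using \<open>symmetric T\<close> symmetric_subgraph_iff[OF T] by blast
  note T_simps = subgraph_simps[OF T]
  obtain x y where x: "x \<in> verts T" "x \<in> carrier G" and y: "y \<in> carrier G" "y \<notin> verts T"
    using \<open>strongly_connected T\<close> not_spanning T_simps(4) by (auto simp: strongly_connected_def)
  obtain w where "w \<in> lists A" "x \<otimes> val w = y"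
    using cayley_dist_attained x y by blast
  then obtain g a where g: "g \<in> verts T" "g \<in> carrier G" "a \<in> A" "g \<otimes> a \<notin> verts T"
    using exit_edge[of x "verts T" w] x y by auto
  define h where "h = g \<otimes> a"
  have h: "h \<in> carrier G" "h \<notin> verts T" "h \<otimes> inv a = g" "h \<noteq> g" using g by (auto simp: h_def)
  define T' where "T' = \<lparr>verts = insert h (verts T), arcs = arcs T \<union> {(g, a), (h, inv a)},
     tail = fst, head = head \<Gamma>\<rparr>"
  have T'_simps: "verts T' = insert h (verts T)" "arcs T' = arcs T \<union> {(g, a), (h, inv a)}"
    by (simp_all add: T'_def)
  have T_ends: "b \<in> A \<and> k \<in> verts T \<and> k \<otimes> b \<in> verts T" if "(k, b) \<in> arcs T" for k b
    using arc_ends_in_verts[OF T that] T_simps(5) that by auto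
  have wf: "wf_digraph T'"
    using T_ends g h inv_A by unfold_locales (auto simp: T'_def h_def)
  have comp: "compatible \<Gamma> T'" "compatible T' T"
    using T by (auto simp: compatible_def T'_def subgraph_def)
  have T': "subgraph T' \<Gamma>"
    using wf comp wf_cayley T_simps g h inv_A by (auto simp: subgraph_def T'_simps)
  have "subgraph T T'"
    using wf comp T_simps by (auto simp: subgraph_def T'_simps)
  moreover have "T' \<noteq> T" using h(2) T'_simps(1) by blast
  moreover have "undirected_tree T'"
    unfolding undirected_tree_def
  proof (intro conjI notI)
    show symmetric: "symmetric T'"
      unfolding symmetric_subgraph_iff[OF T'] T'_simps using sym g h by (auto simp: h_def)
    have to_g: "u \<rightarrow>\<^sup>*\<^bsub>T'\<^esub> g \<and> g \<rightarrow>\<^sup>*\<^bsub>T'\<^esub> u" if "u \<in> verts T'" for u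
    proof (cases "u = h")
      case True
      have "set (walk h [inv a]) \<subseteq> arcs T'" "g = h \<otimes> val [inv a]"
        "set (walk g [a]) \<subseteq> arcs T'" "h = g \<otimes> val [a]"
        using h g by (auto simp: T'_simps h_def)
      then show ?thesis unfolding reachable_subgraph_iff[OF T'] True T'_simps(1)
        using g inv_A by (metis insertI1 insertI2 lists.Cons lists.Nil)
    next
      case False
      then have "u \<rightarrow>\<^sup>*\<^bsub>T\<^esub> g \<and> g \<rightarrow>\<^sup>*\<^bsub>T\<^esub> u"
        using that \<open>strongly_connected T\<close> g by (auto simp: strongly_connected_def T'_simps)
      then show ?thesis
        unfolding reachable_subgraph_iff[OF T] reachable_subgraph_iff[OF T'] T'_simps by blast
    qed
    show "strongly_connected T'"
    proof
      show "verts T' \<noteq> {}" by (simp add: T'_simps)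
      show "u \<rightarrow>\<^sup>*\<^bsub>T'\<^esub> v" if "u \<in> verts T'" "v \<in> verts T'" for u v
        using to_g that wf_digraph.reachable_trans[OF wf] by blast
    qed
    assume "\<exists>p. pre_digraph.cycle T' p \<and> 3 \<le> length p"
    then obtain p where p: "pre_digraph.cycle T' p" "3 \<le> length p" by blast
    note neighbours = long_cycle_neighbours[OF T' symmetric p]
    have "(h, b) \<in> arcs T' \<longleftrightarrow> b = inv a" for b
      using T_ends h g by (auto simp: T'_simps)
    then have no_h: "h \<notin> fst ` set p" using neighbours[of h] by force
    have arcs: "e \<in> arcs T" if e: "e \<in> set p" for e
    proof -
      have x: "fst e \<in> fst ` set p" using e by simp
      have "e \<in> arcs T'"
        using p(1) e unfolding cycle_subgraph_iff[OF T'] by blast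
      then have "e \<in> arcs T \<or> fst e \<otimes> snd e = h \<or> fst e = h"
        by (auto simp: T'_simps h_def)
      moreover have "fst e \<otimes> snd e \<in> fst ` set p"
        using neighbours[OF x] e by (metis prod.collapse)
      ultimately show ?thesis using no_h x by metis
    qed
    obtain u w where uw: "u \<in> verts T'" "w \<in> lists A" "p = walk u w" "u \<otimes> val w = u" "w \<noteq> []"
      "inj_on (\<lambda>i. u \<otimes> val (take (Suc i) w)) {..<length w}"
      using p(1) unfolding cycle_subgraph_iff[OF T'] by blast
    have "u \<in> fst ` set p" using uw(3,5) by (cases w) auto
    then have "u \<in> verts T" using uw(1) no_h by (auto simp: T'_simps)
    then have "pre_digraph.cycle T p"
      unfolding cycle_subgraph_iff[OF T] using uw arcs by blast
    then show False using acyclic[of p] p(2) by simp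
  qed
  ultimately show False using maximal T' by blast
qed

section \<open>Geodesically stackable groups are almost convex\<close>

lemma non_backtracking_walk_iff:
  assumes "g \<in> carrier G" "w \<in> lists A"
  shows "non_backtracking G (walk g w) \<longleftrightarrow> (\<forall>i. Suc i < length w \<longrightarrow> w ! Suc i \<noteq> inv (w ! i))"
  using assms by (simp add: non_backtracking_def nth_walk rev_edge_def mult_val_take_Suc)

lemma cancel_backtracking:
  assumes "w \<in> lists A" "Suc i < length w" "w ! Suc i = inv (w ! i)"
  obtains u v where "w = u @ [w ! i, inv (w ! i)] @ v" "u \<in> lists A" "v \<in> lists A" "w ! i \<in> A"
proof
  show "w = take i w @ [w ! i, inv (w ! i)] @ drop (Suc (Suc i)) w"
    using assms(2,3) by (metis Cons_nth_drop_Suc Suc_lessD append_Cons append_Nil append_take_drop_id)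
  show "take i w \<in> lists A" "drop (Suc (Suc i)) w \<in> lists A" "w ! i \<in> A"
    using assms nth_in_A[of w i] set_drop_subset[of "Suc (Suc i)" w] 
    by (auto simp: in_lists_conv_set dest: in_set_takeD)
qed

text \<open>Deleting an edge followed by its reverse shortens a walk and keeps its endpoints.\<close>

lemma exists_reduced_walk:
  assumes "w \<in> lists A" "set (walk \<one> w) \<subseteq> E"
  shows "\<exists>w'\<in>lists A. val w' = val w \<and> set (walk \<one> w') \<subseteq> E \<and> non_backtracking G (walk \<one> w')"
  using assms
proof (induction "length w" arbitrary: w rule: less_induct)
  case less
  show ?case
  proof (cases "non_backtracking G (walk \<one> w)")
    case False
    then obtain i where "Suc i < length w" "w ! Suc i = inv (w ! i)"
      using less.prems by (auto simp: non_backtracking_walk_iff)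
    then obtain u v a where w: "w = u @ [a, inv a] @ v" "u \<in> lists A" "v \<in> lists A" "a \<in> A"
      using cancel_backtracking less.prems(1) by metis
    have "\<one> \<otimes> val (u @ [a, inv a]) = \<one> \<otimes> val u"
      using w inv_A by simp
    then have "walk \<one> w = walk \<one> u @ walk (\<one> \<otimes> val u) [a, inv a] @ walk (\<one> \<otimes> val u) v"
      using w inv_A walk_append[of \<one> u "[a, inv a] @ v"] walk_append[of "\<one> \<otimes> val u" "[a, inv a]" v]
      by simp
    then have "set (walk \<one> (u @ v)) \<subseteq> E"
      using less.prems(2) w walk_append[of \<one> u v] by simp
    moreover have "val (u @ v) = val w"
      using w inv_A by (simp add: m_assoc[symmetric])
    moreover have "length (u @ v) < length w" "u @ v \<in> lists A" using w by auto
    ultimately show ?thesis using less.hyps[of "u @ v"] by auto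
  qed (use less.prems in blast)
qed

text \<open>Each edge of a walk of length at most 2 contains one of the endpoints of the walk.\<close>

lemma level_walk_le:
  assumes g: "g \<in> carrier G" "norm g = n" "norm (g \<otimes> val w) = n" "w \<in> lists A" "length w \<le> 2"
    and e: "e \<in> set (walk g w)"
  shows "level e \<le> 2 * n + 1"
proof -
  consider "w = []" | a where "w = [a]" | a b where "w = [a, b]"
    using g(5) by (cases w rule: list.exhaust[case_product list.exhaust]) (auto simp: le_Suc_eq length_Suc_conv numeral_2_eq_2)
  then show ?thesis
  proof cases
    case 3
    then have "a \<in> A" "b \<in> A" "g \<otimes> a \<otimes> b = g \<otimes> val w" using g by (auto simp: m_assoc)
    then show ?thesis
      using 3 e g norm_mult_le[of g a] norm_le_mult[of "g \<otimes> a" b] by (auto simp: level_def)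
  qed (use e g in \<open>auto simp: level_def\<close>)
qed

text \<open>
  Let \<open>W g\<close> be a normal form of \<open>g\<close>.  A tree edge at \<open>g\<close> either extends \<open>W g\<close> to a longer normal
  form, which is again geodesic, or it retraces the last edge of \<open>W g\<close>.  Hence every tree edge joins
  a vertex to its parent, which is one step closer to the identity.  Moving each vertex to its
  ancestor in the ball \<open>B(n)\<close> therefore fixes the ball and collapses every tree edge outside it.

  Consequently a path whose edges outside the ball all lie in the tree projects to a path in the
  ball that is not longer.  If a nontree edge is not inside \<open>B(n)\<close>, the flow function replaces it
  by at most \<open>k\<close> edges, which lie in the tree or have smaller level.  For an edge between two
  vertices of \<open>S(n)\<close> one replacement suffices, for an edge from \<open>S(n)\<close> to \<open>S(n + 1)\<close> two suffice.
  Two vertices of \<open>S(n)\<close> at distance at most 2 are joined by at most two edges of these kinds.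
\<close>

lemma almost_convex_if_geodesic_flow:
  assumes "geodesic_flow G A T \<Phi>" shows "almost_convex G A"
proof -
  have max: "maximal_tree G A T"
    and flow_walk: "\<And>g a. g \<in> carrier G \<Longrightarrow> a \<in> A \<Longrightarrow> pre_digraph.awalk \<Gamma> g (\<Phi> (g, a)) (g \<otimes> a)"
    and "bounded_flow G A \<Phi>"
    and geodesic: "\<And>w. w \<in> normal_forms G T \<Longrightarrow> labels_geodesics G A w"
    and decreasing: "\<And>e e'. e \<in> recursive_edges G A T \<Longrightarrow> e' \<in> recursive_edges G A T \<Longrightarrow>
        (e', e) \<in> flow_order G A T \<Phi> \<Longrightarrow> edge_height G A e' < edge_height G A e"
    using assms by (auto simp: geodesic_flow_def flow_function_def)
  from \<open>bounded_flow G A \<Phi>\<close> obtain k where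
    bound: "\<And>e. e \<in> carrier G \<times> A \<Longrightarrow> length (\<Phi> e) \<le> k"
    unfolding bounded_flow_def by auto
  have T: "subgraph T \<Gamma>" and "symmetric T" and "strongly_connected T"
    using max by (auto simp: maximal_tree_def pre_digraph.max_subgraph_def undirected_tree_def)
  have spanning: "verts T = carrier G" by (rule maximal_tree_spanning[OF max])
  have sym: "(g, a) \<in> arcs T \<Longrightarrow> (g \<otimes> a, inv a) \<in> arcs T" for g a
    using \<open>symmetric T\<close> symmetric_subgraph_iff[OF T] by blast
  have arc: "g \<in> carrier G \<and> a \<in> A" if "(g, a) \<in> arcs T" for g a
    using that subgraph_simps(5)[OF T] by auto

  define nf where "nf w \<longleftrightarrow> w \<in> lists A \<and> set (walk \<one> w) \<subseteq> arcs T \<and> non_backtracking G (walk \<one> w)" for w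
  have ex_nf: "\<exists>w. nf w \<and> val w = g" if "g \<in> carrier G" for g
  proof -
    have "\<one> \<rightarrow>\<^sup>*\<^bsub>T\<^esub> g"
      using \<open>strongly_connected T\<close> that by (auto simp: strongly_connected_def spanning)
    then obtain w where "w \<in> lists A" "set (walk \<one> w) \<subseteq> arcs T" "g = val w"
      unfolding reachable_subgraph_iff[OF T] by auto
    then show ?thesis using exists_reduced_walk unfolding nf_def by metis
  qed
  have length_nf: "length w = norm (val w)" if "nf w" for w
  proof -
    have "pre_digraph.awalk T \<one> (walk \<one> w) (\<one> \<otimes> val w)"
      using that unfolding awalk_subgraph_iff[OF T] nf_def spanning by blast
    then have "path_label (walk \<one> w) \<in> normal_forms G T"
      unfolding normal_forms_def using that nf_def by blast
    then have "labels_geodesics G A w" using geodesic by simp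
    moreover have "pre_digraph.awalk \<Gamma> \<one> (walk \<one> w) (val w)"
      using awalk_walk[of \<one> w] that by (simp add: nf_def)
    ultimately show ?thesis unfolding labels_geodesics_def by fastforce
  qed
  define W where "W g = (SOME w. nf w \<and> val w = g)" for g
  have W: "nf (W g)" "val (W g) = g" if "g \<in> carrier G" for g
    using someI_ex[OF ex_nf[OF that]] unfolding W_def by auto
  have W_lists: "W g \<in> lists A" if "g \<in> carrier G" for g
    using W that by (simp add: nf_def)
  define parent where "parent g = val (butlast (W g))" for g
  have butlast: "butlast (W g) \<in> lists A" if "g \<in> carrier G" for g
    using W_lists[OF that] in_set_butlastD[of _ "W g"] by (auto simp: in_lists_conv_set)
  have parent_closed: "parent g \<in> carrier G" if "g \<in> carrier G" for g
    using butlast[OF that] by (simp add: parent_def)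
  have up_or_parent: "norm (g \<otimes> a) = Suc (norm g) \<or> (norm g = Suc (norm (g \<otimes> a)) \<and> g \<otimes> a = parent g)"
    if ga: "(g, a) \<in> arcs T" for g a
  proof -
    have g: "g \<in> carrier G" "a \<in> A" using arc ga by auto
    note wg = W[OF g(1)] W_lists[OF g(1)]
    have ext: "W g @ [a] \<in> lists A" "set (walk \<one> (W g @ [a])) \<subseteq> arcs T"
      using wg g ga by (auto simp: walk_append nf_def)
    show ?thesis
    proof (cases "nf (W g @ [a])")
      case True
      then show ?thesis using length_nf[OF True] length_nf[OF wg(1)] wg g by simp
    next
      case False
      then obtain i where i: "i < length (W g)" "(W g @ [a]) ! Suc i = inv ((W g @ [a]) ! i)"
        using ext by (auto simp: nf_def non_backtracking_walk_iff)
      have "\<not> Suc i < length (W g)"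
        using i wg by (auto simp: nf_def non_backtracking_walk_iff nth_append)
      then have "i = length (W g) - 1" "W g \<noteq> []" using i by auto
      then have "a = inv (last (W g))" using i by (simp add: nth_append last_conv_nth)
      moreover have "W g = butlast (W g) @ [last (W g)]" using \<open>W g \<noteq> []\<close> by simp
      then have "last (W g) \<in> A" "g = parent g \<otimes> last (W g)"
        using wg butlast[OF g(1)] \<open>W g \<noteq> []\<close> last_in_set[of "W g"] 
          val_append[of "butlast (W g)" "[last (W g)]"]
        by (auto simp: parent_def in_lists_conv_set)
      ultimately have "g \<otimes> a = parent g"
        using parent_closed[OF g(1)] by (metis mult_inv_cancel(1))
      moreover have "norm g = Suc (norm (parent g))"
      proof (rule antisym)
        show "norm g \<le> Suc (norm (parent g))"
          using \<open>g \<otimes> a = parent g\<close> g norm_le_mult[of g a] by simp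
        have "norm (parent g) \<le> length (butlast (W g))"
          unfolding parent_def by (rule norm_le[OF butlast[OF g(1)]])
        then show "Suc (norm (parent g)) \<le> norm g"
          using length_nf[OF wg(1)] unfolding wg(2) length_butlast
          using length_greater_0_conv[of "W g"] \<open>W g \<noteq> []\<close> by simp
      qed
      ultimately show ?thesis by simp
    qed
  qed

  \<comment> \<open>The ancestor of \<open>x\<close> in the ball of radius \<open>n\<close>, which collapses the tree outside that ball.\<close>
  define proj where "proj n x = (parent ^^ (norm x - n)) x" for n x
  have proj_closed: "proj n x \<in> carrier G" if "x \<in> carrier G" for n x
  proof -
    have "(parent ^^ m) x \<in> carrier G" for m
      using that parent_closed by (induction m) auto
    then show ?thesis by (simp add: proj_def)
  qed
  have proj_id: "proj n x = x" if "norm x \<le> n" for n x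
    using that by (simp add: proj_def)
  have proj_parent: "proj n x = proj n (parent x)" if "norm x = Suc (norm (parent x))" "n < norm x" for n x
    using that by (simp add: proj_def Suc_diff_le funpow_swap1)

  \<comment> \<open>The projections of \<open>g\<close> and \<open>h\<close> are joined by a path of length at most \<open>m\<close> inside \<open>B(n)\<close>.\<close>
  define conn where "conn n m g h \<longleftrightarrow> (\<exists>w\<in>lists A. proj n g \<otimes> val w = proj n h \<and> length w \<le> m \<and>
      (\<forall>e\<in>set (walk (proj n g) w). level e < 2 * n))" for n m g h
  have conn_refl: "conn n m g h" if "proj n g = proj n h" "g \<in> carrier G" for n m g h
    unfolding conn_def using that(1) proj_closed[OF that(2), of n] by (intro bexI[of _ "[]"]) auto
  have conn_trans: "conn n (m1 + m2) g1 g3" if c: "conn n m1 g1 g2" "conn n m2 g2 g3" "g1 \<in> carrier G"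
    for n m1 m2 g1 g2 g3
  proof -
    obtain w1 where w1: "w1 \<in> lists A" "proj n g1 \<otimes> val w1 = proj n g2" "length w1 \<le> m1"
      "\<forall>e\<in>set (walk (proj n g1) w1). level e < 2 * n" using c(1) unfolding conn_def by blast
    obtain w2 where w2: "w2 \<in> lists A" "proj n g2 \<otimes> val w2 = proj n g3" "length w2 \<le> m2"
      "\<forall>e\<in>set (walk (proj n g2) w2). level e < 2 * n" using c(2) unfolding conn_def by blast
    have g1: "proj n g1 \<in> carrier G" by (rule proj_closed[OF c(3)])
    then have "proj n g1 \<otimes> val (w1 @ w2) = proj n g1 \<otimes> val w1 \<otimes> val w2"
      using w1(1) w2(1) by (simp add: m_assoc)
    moreover have "walk (proj n g1) (w1 @ w2) = walk (proj n g1) w1 @ walk (proj n g2) w2"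
      using walk_append[OF g1 w1(1)] w1(2) by simp
    ultimately show ?thesis unfolding conn_def
      using w1 w2 by (intro bexI[of _ "w1 @ w2"]) auto
  qed
  have conn_mono: "conn n m g h \<Longrightarrow> m \<le> m' \<Longrightarrow> conn n m' g h" for n m m' g h
    unfolding conn_def by (meson order_trans)
  have conn_walk: "conn n (length w * m) g (g \<otimes> val w)"
    if "\<forall>e\<in>set (walk g w). conn n m (fst e) (fst e \<otimes> snd e)" "g \<in> carrier G" "w \<in> lists A" for n m g w
    using that
  proof (induction w arbitrary: g)
    case Nil
    then show ?case using conn_refl by simp
  next
    case (Cons a w)
    then have "conn n (length w * m) (g \<otimes> a) (g \<otimes> a \<otimes> val w)" by (intro Cons.IH) auto
    moreover have "conn n m g (g \<otimes> a)" using Cons.prems by simp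
    ultimately show ?case using conn_trans[of n m g "g \<otimes> a"] Cons.prems by (simp add: m_assoc)
  qed
  have conn_inside: "conn n 1 g (g \<otimes> a)" if "g \<in> carrier G" "a \<in> A" "level (g, a) < 2 * n" for n g a
  proof -
    have "norm g \<le> n" "norm (g \<otimes> a) \<le> n"
      using that norm_mult_le[of g a] norm_le_mult[of g a] by (auto simp: level_def)
    then show ?thesis using that unfolding conn_def
      by (intro bexI[of _ "[a]"]) (auto simp: proj_id)
  qed
  have conn_tree: "conn n 1 g (g \<otimes> a)" if "(g, a) \<in> arcs T" for n g a
  proof (cases "norm g \<le> n \<and> norm (g \<otimes> a) \<le> n")
    case True
    then have "level (g, a) < 2 * n" using up_or_parent[OF that] by (auto simp: level_def)
    then show ?thesis using conn_inside arc[OF that] by blast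
  next
    case False
    have g: "g \<in> carrier G" "a \<in> A" using arc that by auto
    have "norm g \<noteq> Suc (norm (g \<otimes> a))" if "norm (g \<otimes> a) = Suc (norm g)" using that by simp
    moreover have "(g \<otimes> a, inv a) \<in> arcs T" "g \<otimes> a \<otimes> inv a = g" using sym[OF that] g by auto
    ultimately have "(norm (g \<otimes> a) = Suc (norm g) \<and> g = parent (g \<otimes> a)) \<or>
        (norm g = Suc (norm (g \<otimes> a)) \<and> g \<otimes> a = parent g)"
      using up_or_parent[OF that] up_or_parent[of "g \<otimes> a" "inv a"] by auto
    then have "proj n g = proj n (g \<otimes> a)"
      using proj_parent[of g n] proj_parent[of "g \<otimes> a" n] False by auto
    then show ?thesis using conn_refl g by blast
  qed
  have conn_flow: "conn n (Suc k * m) g (g \<otimes> a)"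
    if g: "g \<in> carrier G" "a \<in> A" and "1 \<le> m"
      and lower: "\<And>g' a'. g' \<in> carrier G \<Longrightarrow> a' \<in> A \<Longrightarrow> level (g', a') < level (g, a) \<Longrightarrow> conn n m g' (g' \<otimes> a')"
    for n m g a
  proof (cases "(g, a) \<in> arcs T")
    case True
    have "1 \<le> Suc k * m" using \<open>1 \<le> m\<close> by simp
    then show ?thesis using conn_tree[OF True] conn_mono by blast
  next
    case False
    obtain w where w: "w \<in> lists A" "\<Phi> (g, a) = walk g w" "g \<otimes> a = g \<otimes> val w"
      using flow_walk[OF g] unfolding awalk_cayley_iff by blast
    have "conn n m (fst e) (fst e \<otimes> snd e)" if e: "e \<in> set (walk g w)" for e
    proof -
      have e': "fst e \<in> carrier G" "snd e \<in> A" using set_walk_subset[OF g(1) w(1)] e by auto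
      show ?thesis
      proof (cases "e \<in> arcs T")
        case True
        then have "conn n 1 (fst e) (fst e \<otimes> snd e)" by (intro conn_tree) simp
        then show ?thesis using \<open>1 \<le> m\<close> by (rule conn_mono)
      next
        case nontree: False
        have "(g, a) \<in> recursive_edges G A T" "e \<in> recursive_edges G A T"
          using False nontree g e' by (auto simp: recursive_edges_def mem_Times_iff)
        moreover from this have "(e, (g, a)) \<in> flow_order G A T \<Phi>"
          unfolding flow_order_def using e w(2) by (intro r_into_trancl) auto
        ultimately have "level e < level (g, a)"
          using decreasing[of "(g, a)" e] by (simp add: edge_height_eq)
        then show ?thesis using lower e' by simp
      qed
    qed
    then have "conn n (length w * m) g (g \<otimes> val w)" using conn_walk g w by blast
    moreover have "length w * m \<le> Suc k * m"
      using bound[of "(g, a)"] g w(2) by (intro mult_le_mono1) simp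
    ultimately show ?thesis using conn_mono w(3) by simp
  qed
  have conn_horizontal: "conn n (Suc k) g (g \<otimes> a)"
    if "g \<in> carrier G" "a \<in> A" "level (g, a) \<le> 2 * n" for n g a
    using conn_flow[of g a 1 n] conn_inside that by simp
  have conn_vertical: "conn n (Suc k * Suc k) g (g \<otimes> a)"
    if "g \<in> carrier G" "a \<in> A" "level (g, a) \<le> 2 * n + 1" for n g a
    using that conn_horizontal by (intro conn_flow) auto

  have "\<exists>w\<in>lists A. g \<otimes> val w = h \<and> length w \<le> 2 * (Suc k * Suc k) \<and>
      (\<forall>e\<in>set (walk g w). level e < 2 * norm g)"
    if g: "g \<in> carrier G" "h \<in> carrier G" "norm h = norm g" "cayley_dist G A g h \<le> 2" for g h
  proof -
    obtain w where w: "w \<in> lists A" "g \<otimes> val w = h" "length w \<le> 2"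
      using cayley_dist_attained[OF g(1,2)] g(4) by metis
    have "conn (norm g) (Suc k * Suc k) (fst e) (fst e \<otimes> snd e)" if e: "e \<in> set (walk g w)" for e
      using level_walk_le[OF g(1) _ _ w(1,3) e, of "norm g"] w(2) g(3) set_walk_subset[OF g(1) w(1)] e
      by (intro conn_vertical) auto
    then have "conn (norm g) (length w * (Suc k * Suc k)) g h"
      using conn_walk g w by blast
    then have "conn (norm g) (2 * (Suc k * Suc k)) g h"
      using w(3) conn_mono mult_le_mono1 by blast
    then show ?thesis using g(3) by (simp add: conn_def proj_id)
  qed
  then show ?thesis unfolding almost_convex_iff by blast
qed

end

section \<open>Shortlex normal forms\<close>

locale ordered_generators = symmetric_generators +
  fixes r :: "('a \<times> 'a) set"
  assumes linear_order: "linear_order_on A r"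
begin

abbreviation q :: nat where "q \<equiv> card A"

definition rank :: "'a \<Rightarrow> nat" where "rank a = card {b \<in> A. (b, a) \<in> r}"

lemma rank_less:
  assumes "a \<in> A" "b \<in> A" "(a, b) \<in> r - Id" shows "rank a < rank b"
proof -
  have "trans r" "antisym r" "refl_on A r"
    using linear_order by (auto simp: linear_order_on_def partial_order_on_def preorder_on_def)
  then have "{c \<in> A. (c, a) \<in> r} \<subseteq> {c \<in> A. (c, b) \<in> r}"
    using assms by (auto elim: transE)
  moreover have "b \<in> {c \<in> A. (c, b) \<in> r}" "b \<notin> {c \<in> A. (c, a) \<in> r}"
    using assms \<open>antisym r\<close> \<open>refl_on A r\<close> by (auto dest: antisymD refl_onD)
  ultimately have "{c \<in> A. (c, a) \<in> r} \<subset> {c \<in> A. (c, b) \<in> r}" by blast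
  then show ?thesis unfolding rank_def using finite_A by (intro psubset_card_mono) auto
qed

lemma r_total: "a \<in> A \<Longrightarrow> b \<in> A \<Longrightarrow> a \<noteq> b \<Longrightarrow> (a, b) \<in> r - Id \<or> (b, a) \<in> r - Id"
  using linear_order by (auto simp: linear_order_on_def total_on_def)

lemma rank_inj: "inj_on rank A"
proof
  fix a b assume "a \<in> A" "b \<in> A" "rank a = rank b"
  then show "a = b" using r_total[of a b] rank_less[of a b] rank_less[of b a] by fastforce
qed

lemma rank_image: "rank ` A = {1..q}"
proof (rule card_subset_eq)
  show "rank ` A \<subseteq> {1..q}"
  proof
    fix x assume "x \<in> rank ` A"
    then obtain a where a: "a \<in> A" "x = rank a" by blast
    have "refl_on A r"
      using linear_order by (auto simp: linear_order_on_def partial_order_on_def preorder_on_def)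
    then have "a \<in> {b \<in> A. (b, a) \<in> r}" using a by (auto dest: refl_onD)
    then have "0 < rank a" unfolding rank_def using finite_A by (auto simp: card_gt_0_iff)
    moreover have "rank a \<le> q" unfolding rank_def using finite_A by (intro card_mono) auto
    ultimately show "x \<in> {1..q}" using a by simp
  qed
  show "card (rank ` A) = card {1..q}" by (simp add: card_image rank_inj)
qed simp

lemma rank_bounds: "a \<in> A \<Longrightarrow> 1 \<le> rank a \<and> rank a \<le> q"
  using rank_image by fastforce

text \<open>
  Bijective numeration at the base \<open>q\<close>: a word is read as a numeral with the digits
  \<open>1, \<dots>, q\<close>.  It turns the shortlex order into the order of the natural numbers, and if there
  is a letter at all, every natural number is the number of a unique word.
\<close>

definition num :: "'a list \<Rightarrow> nat" where "num w = foldl (\<lambda>v a. v * q + rank a) 0 w"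

lemma num_Nil [simp]: "num [] = 0"
  by (simp add: num_def)

lemma num_snoc [simp]: "num (w @ [a]) = num w * q + rank a"
  by (simp add: num_def)

lemma num_append: "num (u @ v) = num u * q ^ length v + num v"
proof (induction v rule: rev_induct)
  case (snoc a v)
  have "num (u @ v @ [a]) = num (u @ v) * q + rank a"
    using num_snoc[of "u @ v" a] by simp
  then show ?case using snoc num_snoc[of v a] by (simp add: algebra_simps)
qed simp

text \<open>The number of the first word of length \<open>l\<close> is \<open>1 + q + \<dots> + q\<^sup>l\<^sup>-\<^sup>1\<close>.\<close>

primrec repunit :: "nat \<Rightarrow> nat" where
  "repunit 0 = 0"
| "repunit (Suc l) = repunit l * q + 1"

lemma repunit_Suc: "repunit (Suc l) = repunit l + q ^ l"
  by (induction l) (simp_all add: algebra_simps)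

lemma repunit_mono: "l \<le> l' \<Longrightarrow> repunit l \<le> repunit l'"
  by (rule lift_Suc_mono_le) (simp_all only: repunit_Suc le_add1)

text \<open>
  Longer words thus have greater numbers, as the shortlex order demands.
\<close>

lemma num_length:
  assumes "w \<in> lists A" shows "repunit (length w) \<le> num w \<and> num w < repunit (Suc (length w))"
  using assms
proof (induction w rule: rev_induct)
  case (snoc a w)
  let ?l = "repunit (length w)" and ?u = "repunit (Suc (length w))"
  have IH: "?l \<le> num w" "Suc (num w) \<le> ?u" using snoc by auto
  have a: "1 \<le> rank a" "rank a \<le> q" using rank_bounds snoc.prems by auto
  have "?l * q + 1 \<le> num w * q + rank a"
    using IH(1) a(1) by (intro add_mono mult_le_mono1)
  moreover have "num w * q + rank a \<le> Suc (num w) * q" using a(2) by simp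
  moreover have "Suc (num w) * q \<le> ?u * q" using IH(2) by (rule mult_le_mono1)
  moreover have "?u = ?l * q + 1" by simp
  ultimately show ?case
    unfolding length_append_singleton num_snoc repunit.simps(2)[of "Suc (length w)"] by linarith
qed simp

definition shortlex_less :: "'a list \<Rightarrow> 'a list \<Rightarrow> bool" where
  "shortlex_less u v \<longleftrightarrow> length u < length v \<or> (length u = length v \<and> (u, v) \<in> lex (r - Id))"

lemma num_less_if_shortlex_less:
  assumes uv: "u \<in> lists A" "v \<in> lists A" "shortlex_less u v" shows "num u < num v"
proof (cases "length u < length v")
  case True
  have "num u < repunit (Suc (length u))" using num_length uv(1) by blast
  also have "\<dots> \<le> repunit (length v)" using True by (intro repunit_mono) simp
  also have "\<dots> \<le> num v" using num_length uv(2) by blast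
  finally show ?thesis .
next
  case False
  then have "length u = length v" "(u, v) \<in> lex (r - Id)" using uv(3) by (auto simp: shortlex_less_def)
  \<comment> \<open>The digit at the first difference outweighs the rest, as the rests \<open>u'\<close> and \<open>v'\<close> have the same
    length and their numbers differ by less than \<open>q ^ length u'\<close>.\<close>
  then obtain w a b u' v' where *: "u = w @ a # u'" "v = w @ b # v'" "(a, b) \<in> r - Id"
    "length u' = length v'"
    by (auto simp: lex_conv)
  let ?l = "length u'"
  have A: "a \<in> A" "b \<in> A" "u' \<in> lists A" "v' \<in> lists A" using * uv by auto
  have "num u = (num w * q + rank a) * q ^ ?l + num u'"
    using num_append[of "w @ [a]" u'] * by simp
  also have "num u' < repunit (Suc ?l)" using num_length A by blast
  also have "repunit (Suc ?l) = q ^ ?l + repunit ?l" unfolding repunit_Suc by simp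
  also have "repunit ?l \<le> num v'" using num_length[of v'] A * by simp
  also have "(num w * q + rank a) * q ^ ?l + (q ^ ?l + num v') = (num w * q + Suc (rank a)) * q ^ ?l + num v'"
    by (simp add: algebra_simps)
  also have "\<dots> \<le> (num w * q + rank b) * q ^ ?l + num v'"
    using rank_less[OF A(1,2) *(3)] by (intro add_right_mono mult_le_mono1) simp
  also have "\<dots> = num v" using num_append[of "w @ [b]" v'] * by simp
  finally show ?thesis by simp
qed

lemma shortlex_total:
  assumes "u \<in> lists A" "v \<in> lists A" "u \<noteq> v" shows "shortlex_less u v \<or> shortlex_less v u"
proof (cases "length u = length v")
  case True
  then have "(u, v) \<in> lex (r - Id) \<or> (v, u) \<in> lex (r - Id)"
    using assms
  proof (induction u v rule: list_induct2)
    case (Cons a u b v)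
    then show ?case using r_total[of a b] by (cases "a = b") auto
  qed simp
  then show ?thesis using True by (auto simp: shortlex_less_def)
qed (auto simp: shortlex_less_def)

lemma num_less_iff:
  assumes "u \<in> lists A" "v \<in> lists A" shows "num u < num v \<longleftrightarrow> shortlex_less u v"
  using num_less_if_shortlex_less[of u v] num_less_if_shortlex_less[of v u] shortlex_total[of u v] assms
  by (metis less_asym' less_irrefl)

lemma num_inj: "inj_on num (lists A)"
  using shortlex_total num_less_iff by (metis inj_onI less_irrefl)

lemma length_le_if_num_le:
  assumes "u \<in> lists A" "v \<in> lists A" "num u \<le> num v" shows "length u \<le> length v"
proof (rule ccontr)
  assume "\<not> length u \<le> length v"
  then have "shortlex_less v u" by (simp add: shortlex_less_def)
  then show False using num_less_if_shortlex_less assms by fastforce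
qed

definition nf :: "'a \<Rightarrow> 'a list" where "nf g = (ARG_MIN num w. w \<in> lists A \<and> val w = g)"

lemma nf:
  assumes "g \<in> carrier G"
  shows "nf g \<in> lists A" "val (nf g) = g" and num_nf_le: "w \<in> lists A \<Longrightarrow> val w = g \<Longrightarrow> num (nf g) \<le> num w"
proof -
  obtain v where "v \<in> lists A \<and> val v = g" using exists_word assms by blast
  then have "(nf g \<in> lists A \<and> val (nf g) = g) \<and>
      (\<forall>w. w \<in> lists A \<and> val w = g \<longrightarrow> num (nf g) \<le> num w)"
    unfolding nf_def by (rule arg_min_nat_lemma)
  then show "nf g \<in> lists A" "val (nf g) = g" "w \<in> lists A \<Longrightarrow> val w = g \<Longrightarrow> num (nf g) \<le> num w"
    by blast+
qed

lemma nf_eqI: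
  assumes "w \<in> lists A" "val w = g" "\<And>v. v \<in> lists A \<Longrightarrow> val v = g \<Longrightarrow> num w \<le> num v"
  shows "nf g = w"
proof -
  have g: "g \<in> carrier G" using assms val_closed by blast
  have "num w = num (nf g)" using nf[OF g] num_nf_le[OF g] assms by (intro antisym) auto
  then show ?thesis using num_inj nf[OF g] assms(1) by (auto dest: inj_onD)
qed

lemma shortlex_nf_iff:
  assumes g: "g \<in> carrier G" shows "shortlex_nf G A r g z \<longleftrightarrow> z = nf g"
proof
  assume z: "shortlex_nf G A r g z"
  have "nf g = z"
  proof (rule nf_eqI)
    fix v assume v: "v \<in> lists A" "val v = g"
    show "num z \<le> num v"
    proof (cases "v = z")
      case False
      then have "shortlex_less z v" using z v by (auto simp: shortlex_nf_def shortlex_less_def)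
      then show ?thesis using num_less_if_shortlex_less[of z v] v z by (simp add: shortlex_nf_def)
    qed simp
  qed (use z in \<open>auto simp: shortlex_nf_def\<close>)
  then show "z = nf g" by simp
next
  assume z: "z = nf g"
  show "shortlex_nf G A r g z"
    unfolding shortlex_nf_def
  proof (intro conjI ballI impI)
    fix w assume w: "w \<in> lists A" "val w = g \<and> w \<noteq> z"
    then have "num z < num w"
      using num_nf_le[OF g, of w] num_inj nf(1)[OF g] z by (metis inj_onD le_neq_implies_less)
    then have "shortlex_less z w" using num_less_iff w nf(1)[OF g] z by blast
    then show "length z < length w \<or> length w = length z \<and> (z, w) \<in> lex (r - Id)"
      by (auto simp: shortlex_less_def)
  qed (use nf[OF g] z in auto)
qed

lemma length_nf: "g \<in> carrier G \<Longrightarrow> length (nf g) = norm g"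
proof (rule antisym)
  assume g: "g \<in> carrier G"
  obtain w where "w \<in> lists A" "val w = g" "length w = norm g" using norm_attained g by blast
  then show "length (nf g) \<le> norm g"
    using length_le_if_num_le[of "nf g" w] nf[OF g] num_nf_le[OF g] by simp
  show "norm g \<le> length (nf g)" using norm_le[of "nf g"] nf[OF g] by simp
qed

lemma nf_one [simp]: "nf \<one> = []"
  using length_nf[of \<one>] by simp

text \<open>
  A smaller representative of the prefix could be substituted in the normal form of \<open>g\<close>.
\<close>

lemma nf_butlast:
  assumes "g \<in> carrier G" "nf g = z @ [b]" shows "z = nf (val z)"
proof -
  have A: "z \<in> lists A" "b \<in> A" using nf(1)[OF assms(1)] assms(2) by auto
  then have "0 < q" using finite_A card_gt_0_iff by blast
  have "nf (val z) = z"
  proof (rule nf_eqI)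
    fix v assume v: "v \<in> lists A" "val v = val z"
    then have "val (v @ [b]) = g" using A nf(2)[OF assms(1)] assms(2) by simp
    then have "num (z @ [b]) \<le> num (v @ [b])"
      using num_nf_le[OF assms(1), of "v @ [b]"] v A assms(2) by simp
    then show "num z \<le> num v" using \<open>0 < q\<close> by simp
  qed (use A in auto)
  then show ?thesis by simp
qed

section \<open>The tree of shortlex normal forms\<close>

definition tree_edge :: "'a \<Rightarrow> 'a \<Rightarrow> bool" where
  "tree_edge g a \<longleftrightarrow> nf (g \<otimes> a) = nf g @ [a] \<or> nf g = nf (g \<otimes> a) @ [inv a]"

definition nf_tree :: "('a, 'a \<times> 'a) pre_digraph" where
  "nf_tree = \<lparr>verts = carrier G, arcs = {(g, a). g \<in> carrier G \<and> a \<in> A \<and> tree_edge g a},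
     tail = fst, head = head \<Gamma>\<rparr>"

lemma nf_tree_simps [simp]:
  "verts nf_tree = carrier G" "(g, a) \<in> arcs nf_tree \<longleftrightarrow> g \<in> carrier G \<and> a \<in> A \<and> tree_edge g a"
  by (auto simp: nf_tree_def)

lemma subgraph_nf_tree: "subgraph nf_tree \<Gamma>"
proof -
  have "wf_digraph nf_tree" by unfold_locales (auto simp: nf_tree_def)
  then show ?thesis using wf_cayley by (auto simp: subgraph_def compatible_def nf_tree_def)
qed

lemma symmetric_nf_tree: "symmetric nf_tree"
  unfolding symmetric_subgraph_iff[OF subgraph_nf_tree] using inv_A by (auto simp: tree_edge_def)

lemma walk_nf_in_tree:
  assumes "g \<in> carrier G" shows "set (walk \<one> (nf g)) \<subseteq> arcs nf_tree"
  using assms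
proof (induction "length (nf g)" arbitrary: g rule: less_induct)
  case less
  show ?case
  proof (cases "nf g" rule: rev_cases)
    case (snoc z b)
    then have A: "z \<in> lists A" "b \<in> A" using nf(1)[OF less.prems] by auto
    have z: "z = nf (val z)" using nf_butlast less.prems snoc .
    have "val z \<otimes> b = g" using A nf(2)[OF less.prems] snoc by simp
    then have "tree_edge (val z) b" using snoc z by (simp add: tree_edge_def)
    moreover have "set (walk \<one> z) \<subseteq> arcs nf_tree"
      using less.hyps[of "val z"] z snoc A by simp
    ultimately show ?thesis using snoc A by (simp add: walk_append)
  qed simp
qed

lemma strongly_connected_nf_tree: "strongly_connected nf_tree"
proof
  show "verts nf_tree \<noteq> {}" by auto
  have "\<one> \<rightarrow>\<^sup>*\<^bsub>nf_tree\<^esub> g" if "g \<in> carrier G" for g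
    unfolding reachable_subgraph_iff[OF subgraph_nf_tree]
    using walk_nf_in_tree[OF that] nf[OF that] that by (intro conjI bexI[of _ "nf g"]) auto
  then show "g \<rightarrow>\<^sup>*\<^bsub>nf_tree\<^esub> h" if "g \<in> verts nf_tree" "h \<in> verts nf_tree" for g h
    using that symmetric_reachable[OF symmetric_nf_tree]
      wf_digraph.reachable_trans[OF subgraph_simps(1)[OF subgraph_nf_tree]]
    by (metis nf_tree_simps(1))
qed

text \<open>
  A vertex of greatest norm on a cycle has both its neighbours one step closer to the identity;
  but it has only one such neighbour in the tree, its parent.
\<close>

lemma nf_tree_acyclic:
  assumes "pre_digraph.cycle nf_tree p" "3 \<le> length p" shows False
proof -
  let ?V = "fst ` set p"
  have "?V \<noteq> {}" using assms(2) by auto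
  then have "Max (norm ` ?V) \<in> norm ` ?V" by (intro Max_in) auto
  then obtain x where x: "x \<in> ?V" "norm x = Max (norm ` ?V)" by force
  obtain a b where ab: "a \<noteq> b" "(x, a) \<in> arcs nf_tree" "(x, b) \<in> arcs nf_tree"
    "x \<otimes> a \<in> ?V" "x \<otimes> b \<in> ?V"
    using long_cycle_neighbours[OF subgraph_nf_tree symmetric_nf_tree assms x(1)] by blast
  have parent: "nf x = nf (x \<otimes> c) @ [inv c]" if "(x, c) \<in> arcs nf_tree" "x \<otimes> c \<in> ?V" for c
  proof -
    have "norm (x \<otimes> c) \<le> norm x" using x(2) that(2) by simp
    then have "length (nf (x \<otimes> c)) \<noteq> Suc (length (nf x))"
      using that length_nf by simp
    then show ?thesis using that by (auto simp: tree_edge_def)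
  qed
  then have "inv a = inv b" using parent[OF ab(2,4)] parent[OF ab(3,5)] by simp
  then show False using ab inv_inj inv_inv by (metis A_carrier nf_tree_simps(2))
qed

text \<open>
  A further edge \<open>(g, a)\<close> would close a cycle with the simple tree path from its head to its tail.
  That path has length at least 2, since the only edge from \<open>g \<otimes> a\<close> to \<open>g\<close> is the reverse of the
  given one.
\<close>

lemma maximal_nf_tree: "maximal_tree G A nf_tree"
proof -
  note wf = subgraph_simps(1)[OF subgraph_nf_tree]
  have "undirected_tree nf_tree"
    unfolding undirected_tree_def
    using symmetric_nf_tree strongly_connected_nf_tree nf_tree_acyclic by blast
  moreover have False
    if T': "subgraph nf_tree T'" "subgraph T' \<Gamma>" "T' \<noteq> nf_tree" "undirected_tree T'" for T'
  proof -
    note wf' = subgraph_simps(1)[OF T'(2)]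
    have "verts T' = verts nf_tree" using T' by (auto simp: subgraph_def)
    moreover have "tail T' = tail nf_tree" "head T' = head nf_tree"
      using T' by (auto simp: subgraph_def compatible_def)
    ultimately have "arcs T' \<noteq> arcs nf_tree" using T'(3) by (metis pre_digraph.equality old.unit.exhaust)
    moreover have "arcs nf_tree \<subseteq> arcs T'" using T'(1) by (simp add: subgraph_def)
    ultimately obtain g a where e: "(g, a) \<in> arcs T'" "(g, a) \<notin> arcs nf_tree"
      by (metis subset_antisym subrelI)
    then have g: "g \<in> carrier G" "a \<in> A" using subgraph_simps(5)[OF T'(2)] by auto
    have "(g \<otimes> a) \<rightarrow>\<^sup>*\<^bsub>nf_tree\<^esub> g"
      using strongly_connected_nf_tree g by (auto simp: strongly_connected_def)
    then obtain p where p: "pre_digraph.apath nf_tree (g \<otimes> a) p g"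
      using wf_digraph.reachable_apath[OF wf] by blast
    then have p': "pre_digraph.awalk nf_tree (g \<otimes> a) p g" by (simp add: pre_digraph.apath_def)
    then obtain w where w: "w \<in> lists A" "p = walk (g \<otimes> a) w" "set p \<subseteq> arcs nf_tree" "g = g \<otimes> a \<otimes> val w"
      unfolding awalk_subgraph_iff[OF subgraph_nf_tree] by blast
    have "2 \<le> length w"
    proof (rule ccontr)
      assume "\<not> 2 \<le> length w"
      then consider "w = []" | b where "w = [b]"
        by (cases w rule: list.exhaust[case_product list.exhaust]) (auto simp: not_le less_Suc_eq numeral_2_eq_2)
      then show False
      proof cases
        case 1
        then show False using w g one_notin_A by simp
      next
        case 2
        then have "b = inv a" using edge_eq_iff[OF g, of b] w by auto
        then have "(g \<otimes> a, inv a) \<in> arcs nf_tree" using w 2 by simp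
        then have "(g \<otimes> a \<otimes> inv a, inv (inv a)) \<in> arcs nf_tree"
          using symmetric_nf_tree symmetric_subgraph_iff[OF subgraph_nf_tree] by blast
        then show False using e g by simp
      qed
    qed
    have "pre_digraph.awalk T' (g \<otimes> a) p g"
      unfolding awalk_subgraph_iff[OF T'(2)] using w T'(1) g
      by (intro conjI bexI[of _ w]) (auto simp: subgraph_def)
    moreover have "pre_digraph.awalk T' g [(g, a)] (g \<otimes> a)"
      unfolding awalk_subgraph_iff[OF T'(2)] using e g arc_ends_in_verts[OF T'(2) e(1)]
      by (intro conjI bexI[of _ "[a]"]) auto
    ultimately have walk: "pre_digraph.awalk T' (g \<otimes> a) (p @ [(g, a)]) (g \<otimes> a)"
      by (rule wf_digraph.awalk_appendI[OF wf'])
    have verts: "pre_digraph.awalk_verts T' = pre_digraph.awalk_verts nf_tree"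
      using compatible_awalk_verts[of T' nf_tree] T'(1) by (simp add: subgraph_def)
    have ends: "hd (pre_digraph.awalk_verts nf_tree (g \<otimes> a) p) = g \<otimes> a"
      "last (pre_digraph.awalk_verts nf_tree (g \<otimes> a) p) = g"
      using wf_digraph.awends_of_awalk[OF wf p'] by auto
    have "pre_digraph.awalk_verts T' (g \<otimes> a) (p @ [(g, a)]) =
        pre_digraph.awalk_verts nf_tree (g \<otimes> a) p @ [g \<otimes> a]"
      using wf_digraph.awalk_verts_append[OF wf' walk]
      by (simp add: verts ends pre_digraph.awalk_verts.simps nf_tree_def)
    moreover have "distinct (pre_digraph.awalk_verts nf_tree (g \<otimes> a) p)"
      using p by (simp add: pre_digraph.apath_def)
    moreover obtain vs where "pre_digraph.awalk_verts nf_tree (g \<otimes> a) p = (g \<otimes> a) # vs"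
      using ends(1) by (metis list.collapse pre_digraph.awalk_verts_non_Nil)
    ultimately have "distinct (tl (pre_digraph.awalk_verts T' (g \<otimes> a) (p @ [(g, a)])))" by simp
    then have "pre_digraph.cycle T' (p @ [(g, a)])"
      unfolding pre_digraph.cycle_def using walk by blast
    moreover have "3 \<le> length (p @ [(g, a)])" using \<open>2 \<le> length w\<close> w by simp
    ultimately show False using T'(4) unfolding undirected_tree_def by blast
  qed
  ultimately show ?thesis
    unfolding maximal_tree_def pre_digraph.max_subgraph_def using subgraph_nf_tree by blast
qed

lemma non_backtracking_nf:
  assumes "g \<in> carrier G" shows "non_backtracking G (walk \<one> (nf g))"
proof (rule ccontr)
  assume "\<not> non_backtracking G (walk \<one> (nf g))"
  then obtain i where "Suc i < length (nf g)" "nf g ! Suc i = inv (nf g ! i)"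
    using nf(1)[OF assms] by (auto simp: non_backtracking_walk_iff)
  then obtain u v a where w: "nf g = u @ [a, inv a] @ v" "u \<in> lists A" "v \<in> lists A" "a \<in> A"
    using cancel_backtracking nf(1)[OF assms] by metis
  then have "val (u @ v) = g" using nf(2)[OF assms] inv_A by (simp add: m_assoc[symmetric])
  then have "norm g \<le> length (u @ v)" using norm_le[of "u @ v"] w by simp
  then show False using length_nf[OF assms] w by simp
qed

text \<open>
  A walk that has followed a normal form up the tree can only extend it or retrace its last letter.
\<close>

lemma nf_if_non_backtracking:
  assumes "w \<in> lists A" "set (walk \<one> w) \<subseteq> arcs nf_tree" "non_backtracking G (walk \<one> w)"
  shows "w = nf (val w)"
  using assms
proof (induction w rule: rev_induct)
  case (snoc b z)
  have A: "z \<in> lists A" "b \<in> A" using snoc.prems by auto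
  have "non_backtracking G (walk \<one> z)"
    unfolding non_backtracking_walk_iff[OF one_closed A(1)]
  proof (intro allI impI)
    fix i assume "Suc i < length z"
    then show "z ! Suc i \<noteq> inv (z ! i)"
      using snoc.prems(3)[unfolded non_backtracking_walk_iff[OF one_closed snoc.prems(1)], rule_format, of i]
      by (simp add: nth_append)
  qed
  then have z: "z = nf (val z)" using snoc A by (simp add: walk_append)
  have "tree_edge (val z) b" using snoc.prems(2) A by (simp add: walk_append)
  then consider "nf (val z \<otimes> b) = nf (val z) @ [b]" | "nf (val z) = nf (val z \<otimes> b) @ [inv b]"
    unfolding tree_edge_def by blast
  then show ?case
  proof cases
    case 1
    then show ?thesis using z A by simp
  next
    case 2
    define y where "y = nf (val z \<otimes> b)"
    have "z = y @ [inv b]" using 2 z y_def by simp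
    then have "(z @ [b]) ! Suc (length y) = inv ((z @ [b]) ! length y)" "Suc (length y) < length (z @ [b])"
      using A by (simp_all add: nth_append)
    then show ?thesis
      using snoc.prems(3)[unfolded non_backtracking_walk_iff[OF one_closed snoc.prems(1)]] by blast
  qed
qed simp

lemma normal_forms_nf_tree: "normal_forms G nf_tree = nf ` carrier G"
proof
  show "normal_forms G nf_tree \<subseteq> nf ` carrier G"
  proof
    fix z assume "z \<in> normal_forms G nf_tree"
    then obtain p g where p: "z = path_label p" "pre_digraph.awalk nf_tree \<one> p g" "non_backtracking G p"
      by (auto simp: normal_forms_def)
    then obtain w where "w \<in> lists A" "p = walk \<one> w" "set p \<subseteq> arcs nf_tree"
      unfolding awalk_subgraph_iff[OF subgraph_nf_tree] by blast
    then have "w \<in> lists A" "z = w" "w = nf (val w)" using p nf_if_non_backtracking by auto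
    then show "z \<in> nf ` carrier G" using val_closed by blast
  qed
  show "nf ` carrier G \<subseteq> normal_forms G nf_tree"
  proof
    fix z assume "z \<in> nf ` carrier G"
    then obtain g where g: "g \<in> carrier G" "z = nf g" by blast
    have "pre_digraph.awalk nf_tree \<one> (walk \<one> z) (\<one> \<otimes> val z)"
      unfolding awalk_subgraph_iff[OF subgraph_nf_tree]
      using walk_nf_in_tree[OF g(1)] nf(1)[OF g(1)] g(2) by auto
    moreover have "non_backtracking G (walk \<one> z)" using non_backtracking_nf g by simp
    ultimately show "z \<in> normal_forms G nf_tree"
      unfolding normal_forms_def using path_label_walk[of \<one> z] by (smt (verit) mem_Collect_eq)
  qed
qed

text \<open>The path metric is invariant under left multiplication.\<close>

lemma labels_geodesics_nf:
  assumes "g \<in> carrier G" shows "labels_geodesics G A (nf g)"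
  unfolding labels_geodesics_def awalk_cayley_iff
proof (intro allI impI)
  fix u p v
  assume "(u \<in> carrier G \<and> (\<exists>w\<in>lists A. p = walk u w \<and> v = u \<otimes> val w)) \<and> path_label p = nf g"
  then have u: "u \<in> carrier G" "p = walk u (nf g)" "v = u \<otimes> g"
    using nf(2)[OF assms] by auto
  obtain w where w: "w \<in> lists A" "u \<otimes> val w = v" "length w = cayley_dist G A u v"
    using cayley_dist_attained[of u v] u assms by auto
  then have "val w = g" using u assms by simp
  then have "norm g \<le> cayley_dist G A u v" using norm_le w by metis
  moreover have "cayley_dist G A u v \<le> norm g"
    using cayley_dist_le[OF u(1) nf(1)[OF assms]] nf(2)[OF assms] u length_nf[OF assms] by simp
  ultimately show "length p = cayley_dist G A u v" using u length_nf[OF assms] by simp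
qed

section \<open>The flow function of an almost convex group\<close>

lemma norm_tail_le:
  assumes "e \<in> carrier G \<times> A" "level e < 2 * n" shows "norm (fst e) \<le> n"
  using assms norm_le_mult[of "fst e" "snd e"] by (auto simp: level_def)

lemma nf_parent:
  assumes "g \<in> carrier G" "norm g = Suc n"
  obtains h b where "h \<in> carrier G" "b \<in> A" "h \<otimes> b = g" "norm h = n" "nf g = nf h @ [b]"
proof -
  obtain z b where z: "nf g = z @ [b]"
    using length_nf[OF assms(1)] assms(2) by (cases "nf g" rule: rev_cases) auto
  then have A: "z \<in> lists A" "b \<in> A" using nf(1)[OF assms(1)] by auto
  have "z = nf (val z)" using nf_butlast[OF assms(1) z] .
  moreover have "val z \<otimes> b = g" using A nf(2)[OF assms(1)] z by simp
  moreover have "norm (val z) = n"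
    using length_nf[of "val z"] A length_nf[OF assms(1)] z assms(2) \<open>z = nf (val z)\<close> by simp
  ultimately show ?thesis using that[of "val z" b] A z by simp
qed

text \<open>
  The two halves of almost convexity.  A horizontal edge is bypassed inside the ball.  For an edge
  that joins the spheres of radius \<open>n\<close> and \<open>n + 1\<close>, the outer vertex is left through its tree edge,
  whose inner vertex is at distance at most 2 from the inner vertex of the given edge.
\<close>

lemma exists_short_detours:
  assumes "almost_convex G A"
  shows "\<exists>K. \<forall>g\<in>carrier G. \<forall>a\<in>A. \<not> tree_edge g a \<longrightarrow>
    (\<exists>v\<in>lists A. val v = a \<and> length v \<le> K \<and>
      (\<forall>e\<in>set (walk g v). norm (fst e) \<le> norm g \<and> (e \<in> arcs nf_tree \<or> level e < level (g, a))))"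
proof -
  obtain k where AC: "\<And>g h. g \<in> carrier G \<Longrightarrow> h \<in> carrier G \<Longrightarrow> norm h = norm g \<Longrightarrow>
      cayley_dist G A g h \<le> 2 \<Longrightarrow>
      \<exists>v\<in>lists A. g \<otimes> val v = h \<and> length v \<le> k \<and> (\<forall>e\<in>set (walk g v). level e < 2 * norm g)"
    using assms unfolding almost_convex_iff by metis
  have "\<exists>v\<in>lists A. g \<otimes> val v = g \<otimes> a \<and> length v \<le> Suc k \<and>
      (\<forall>e\<in>set (walk g v). norm (fst e) \<le> norm g \<and> (e \<in> arcs nf_tree \<or> level e < level (g, a)))"
    if g: "g \<in> carrier G" "a \<in> A" for g a
  proof -
    have ga: "g \<otimes> a \<in> carrier G" using g by simp
    consider "norm (g \<otimes> a) = norm g" | "norm (g \<otimes> a) = Suc (norm g)" | "norm g = Suc (norm (g \<otimes> a))"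
      using norm_mult_le[OF g] norm_le_mult[OF g] by linarith
    then show ?thesis
    proof cases
      case 1
      have "cayley_dist G A g (g \<otimes> a) \<le> 2"
        using cayley_dist_le[of g "[a]"] g by simp
      then obtain v where v: "v \<in> lists A" "g \<otimes> val v = g \<otimes> a" "length v \<le> k"
        "\<forall>e\<in>set (walk g v). level e < 2 * norm g"
        using AC[OF g(1) ga 1] by blast
      moreover have "norm (fst e) \<le> norm g" if "e \<in> set (walk g v)" for e
        using that v set_walk_subset[OF g(1) v(1)] by (intro norm_tail_le) auto
      moreover have "level (g, a) = 2 * norm g" using 1 by (simp add: level_def)
      ultimately show ?thesis by (intro bexI[of _ v]) auto
    next
      case 2
      obtain h b where h: "h \<in> carrier G" "b \<in> A" "h \<otimes> b = g \<otimes> a" "norm h = norm g"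
        "nf (g \<otimes> a) = nf h @ [b]"
        by (rule nf_parent[OF ga 2])
      have "g \<otimes> val [a, inv b] = g \<otimes> a \<otimes> inv b"
        using g h by (simp add: m_assoc)
      then have eq: "g \<otimes> val [a, inv b] = h"
        using h(1,2) unfolding h(3)[symmetric] by simp
      have "cayley_dist G A g h \<le> 2"
        using cayley_dist_le[OF g(1), of "[a, inv b]"] g(2) h(2) inv_A unfolding eq by simp
      then obtain v where v: "v \<in> lists A" "g \<otimes> val v = h" "length v \<le> k"
        "\<forall>e\<in>set (walk g v). level e < 2 * norm g"
        using AC[OF g(1) h(1) h(4)] by blast
      have "tree_edge h b" using h by (simp add: tree_edge_def)
      moreover have "norm (fst e) \<le> norm g" if "e \<in> set (walk g v)" for e
        using that v set_walk_subset[OF g(1) v(1)] by (intro norm_tail_le) auto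
      moreover have "2 * norm g \<le> level (g, a)" using 2 by (simp add: level_def)
      moreover have "walk g (v @ [b]) = walk g v @ [(h, b)]"
        using walk_append[OF g(1) v(1)] v by simp
      moreover have "g \<otimes> val (v @ [b]) = g \<otimes> a"
        using v g h by (simp add: m_assoc[symmetric])
      ultimately show ?thesis
        using v h by (intro bexI[of _ "v @ [b]"]) (auto dest: less_le_trans)
    next
      case 3
      obtain h b where h: "h \<in> carrier G" "b \<in> A" "h \<otimes> b = g" "norm h = norm (g \<otimes> a)"
        "nf g = nf h @ [b]"
        by (rule nf_parent[OF g(1) 3])
      have "h \<otimes> val [b, a] = g \<otimes> a" using g h by (simp add: m_assoc[symmetric])
      then have "cayley_dist G A h (g \<otimes> a) \<le> 2"
        using cayley_dist_le[of h "[b, a]"] g h by simp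
      then obtain v where v: "v \<in> lists A" "h \<otimes> val v = g \<otimes> a" "length v \<le> k"
        "\<forall>e\<in>set (walk h v). level e < 2 * norm h"
        using AC[OF h(1) ga] h(4) by metis
      have gb: "g \<otimes> inv b = h" using h by auto
      then have "tree_edge g (inv b)" using h by (simp add: tree_edge_def)
      moreover have "norm (fst e) \<le> norm g" if "e \<in> set (walk h v)" for e
      proof -
        have "norm (fst e) \<le> norm h"
          using that v set_walk_subset[OF h(1) v(1)] by (intro norm_tail_le) auto
        then show ?thesis using h(4) 3 by simp
      qed
      moreover have "2 * norm h \<le> level (g, a)" using h(4) 3 by (simp add: level_def)
      moreover have "g \<otimes> val (inv b # v) = g \<otimes> a"
        using v g h gb inv_A by (simp add: m_assoc[symmetric])
      ultimately show ?thesis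
        using v g h inv_A gb by (intro bexI[of _ "inv b # v"]) (auto dest: less_le_trans)
    qed
  qed
  moreover have "val v = a"
    if "g \<otimes> val v = g \<otimes> a" "g \<in> carrier G" "a \<in> A" "v \<in> lists A" for g a v
    using that val_closed[of v] by simp
  ultimately show ?thesis by (intro exI[of _ "Suc k"]) metis
qed

end

text \<open>
  The nontree edges of a detour have smaller level than the edge it replaces, which makes the flow
  function well-founded; that a detour starts each of its edges inside the ball through the tail of
  that edge bounds the search in the solution of the word problem.
\<close>

locale short_detours = ordered_generators +
  fixes K :: nat
  assumes detour: "g \<in> carrier G \<Longrightarrow> a \<in> A \<Longrightarrow> \<not> tree_edge g a \<Longrightarrow>
      \<exists>v\<in>lists A. val v = a \<and> length v \<le> K \<and>
        (\<forall>e\<in>set (walk g v). norm (fst e) \<le> norm g \<and> (e \<in> arcs nf_tree \<or> level e < level (g, a)))"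
begin

definition candidates :: "'a \<Rightarrow> 'a list set" where
  "candidates a = {v \<in> lists A. length v \<le> K \<and> val v = a}"

definition admissible :: "'a \<Rightarrow> 'a \<Rightarrow> 'a list \<Rightarrow> bool" where
  "admissible g a v \<longleftrightarrow> (\<forall>e\<in>set (walk g v). e \<in> arcs nf_tree \<or> level e < level (g, a))"

text \<open>
  Among finitely many candidates, the least admissible one is chosen, so that the label is
  computable as soon as admissibility is decidable.
\<close>

definition flow_label :: "'a \<Rightarrow> 'a \<Rightarrow> 'a list" where
  "flow_label g a =
     (if tree_edge g a then [a] else (ARG_MIN num v. v \<in> candidates a \<and> admissible g a v))"

definition flow :: "'a \<times> 'a \<Rightarrow> ('a \<times> 'a) list" where
  "flow e = walk (fst e) (flow_label (fst e) (snd e))"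

lemma finite_candidates: "finite (candidates a)"
  by (rule finite_subset[OF _ finite_lists_length_le[OF finite_A, of K]])
    (auto simp: candidates_def in_lists_conv_set)

lemma flow_label_nontree:
  assumes "g \<in> carrier G" "a \<in> A" "\<not> tree_edge g a"
  shows "flow_label g a \<in> candidates a" "admissible g a (flow_label g a)"
    and "v \<in> candidates a \<Longrightarrow> admissible g a v \<Longrightarrow> num (flow_label g a) \<le> num v"
proof -
  obtain v0 where "v0 \<in> candidates a \<and> admissible g a v0"
    using detour[OF assms] by (auto simp: candidates_def admissible_def)
  then have "(flow_label g a \<in> candidates a \<and> admissible g a (flow_label g a)) \<and>
      (\<forall>v. v \<in> candidates a \<and> admissible g a v \<longrightarrow> num (flow_label g a) \<le> num v)"
    unfolding flow_label_def using assms(3) by (simp only: if_False) (rule arg_min_nat_lemma)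
  then show "flow_label g a \<in> candidates a" "admissible g a (flow_label g a)"
    "v \<in> candidates a \<Longrightarrow> admissible g a v \<Longrightarrow> num (flow_label g a) \<le> num v" by blast+
qed

lemma flow_label_eq_iff:
  assumes "g \<in> carrier G" "a \<in> A"
  shows "flow_label g a = v \<longleftrightarrow> (if tree_edge g a then v = [a]
    else v \<in> candidates a \<and> admissible g a v \<and> (\<forall>u\<in>candidates a. admissible g a u \<longrightarrow> num v \<le> num u))"
proof (cases "tree_edge g a")
  case False
  note lab = flow_label_nontree[OF assms False]
  have "flow_label g a = v"
    if v: "v \<in> candidates a" "admissible g a v" "\<forall>u\<in>candidates a. admissible g a u \<longrightarrow> num v \<le> num u"
  proof (rule inj_onD[OF num_inj])
    show "num (flow_label g a) = num v" using v lab by (simp add: antisym)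
  qed (use v lab in \<open>auto simp: candidates_def\<close>)
  then show ?thesis using lab False by auto
qed (auto simp: flow_label_def)

lemma flow_label:
  assumes "g \<in> carrier G" "a \<in> A"
  shows "flow_label g a \<in> lists A" "val (flow_label g a) = a" "length (flow_label g a) \<le> max 1 K"
proof -
  have "flow_label g a \<in> lists A \<and> val (flow_label g a) = a \<and> length (flow_label g a) \<le> max 1 K"
  proof (cases "tree_edge g a")
    case False
    then show ?thesis using flow_label_nontree(1)[OF assms] by (auto simp: candidates_def)
  qed (use assms in \<open>simp add: flow_label_def\<close>)
  then show "flow_label g a \<in> lists A" "val (flow_label g a) = a" "length (flow_label g a) \<le> max 1 K"
    by blast+
qed

lemma flow_order_level: "(e', e) \<in> flow_order G A nf_tree flow \<Longrightarrow> level e' < level e"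
  unfolding flow_order_def
proof (induction rule: trancl_induct)
  case (base e)
  obtain g a where e: "e = (g, a)" by (cases e)
  with base have g: "g \<in> carrier G" "a \<in> A" "\<not> tree_edge g a" "e' \<in> set (walk g (flow_label g a))"
    "e' \<notin> arcs nf_tree"
    by (auto simp: recursive_edges_def flow_def)
  then show ?case using flow_label_nontree(2)[OF g(1-3)] e by (auto simp: admissible_def)
next
  case (step e e'')
  obtain g a where e: "e'' = (g, a)" by (cases e'')
  with step have g: "g \<in> carrier G" "a \<in> A" "\<not> tree_edge g a" "e \<in> set (walk g (flow_label g a))"
    "e \<notin> arcs nf_tree"
    by (auto simp: recursive_edges_def flow_def)
  then have "level e < level e''" using flow_label_nontree(2)[OF g(1-3)] e by (auto simp: admissible_def)
  then show ?case using step.IH by simp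
qed

lemma geodesic_flow: "geodesic_flow G A nf_tree flow"
  unfolding geodesic_flow_def
proof (intro conjI ballI impI)
  show "flow_function G A nf_tree flow"
    unfolding flow_function_def
  proof (intro conjI ballI)
    show "maximal_tree G A nf_tree" by (rule maximal_nf_tree)
    fix e assume "e \<in> arcs \<Gamma>"
    then obtain g a where e: "e = (g, a)" "g \<in> carrier G" "a \<in> A" by (cases e) auto
    then show "pre_digraph.awalk \<Gamma> (tail \<Gamma> e) (flow e) (head \<Gamma> e)"
      using awalk_walk[OF e(2) flow_label(1)[OF e(2,3)]] flow_label(2)[OF e(2,3)] by (simp add: flow_def)
  next
    fix e assume "e \<in> arcs nf_tree"
    then show "flow e = [e]" by (cases e) (simp add: flow_def flow_label_def)
  next
    show "trans (flow_order G A nf_tree flow)" unfolding flow_order_def by (rule trans_trancl)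
    have sub: "flow_order G A nf_tree flow \<subseteq> measure level"
      using flow_order_level by auto
    show "wf (flow_order G A nf_tree flow)" by (rule wf_subset[OF wf_measure sub])
    show "irrefl (flow_order G A nf_tree flow)" using flow_order_level by (auto simp: irrefl_def)
  qed
  show "bounded_flow G A flow"
    unfolding bounded_flow_def using flow_label(3) by (intro exI[of _ "max 1 K"]) (auto simp: flow_def)
  show "labels_geodesics G A w" if "w \<in> normal_forms G nf_tree" for w
    using that labels_geodesics_nf normal_forms_nf_tree by auto
  show "edge_height G A e' < edge_height G A e" if "(e', e) \<in> flow_order G A nf_tree flow" for e e'
    using flow_order_level[OF that] by (simp add: edge_height_eq)
qed

lemma normal_forms_shortlex: "normal_forms G nf_tree = {z. \<exists>g\<in>carrier G. shortlex_nf G A r g z}"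
  unfolding normal_forms_nf_tree using shortlex_nf_iff by auto

end

context ordered_generators
begin

section \<open>Words as natural numbers\<close>

lemma num_surj:
  assumes "A \<noteq> {}" shows "\<exists>w\<in>lists A. num w = x"
proof (induction x rule: less_induct)
  case (less x)
  have q: "0 < q" using assms finite_A by (simp add: card_gt_0_iff)
  show ?case
  proof (cases x)
    case 0
    then show ?thesis by (intro bexI[of _ "[]"]) auto
  next
    case (Suc y)
    have "Suc (y mod q) \<in> rank ` A" unfolding rank_image using q by (simp add: Suc_le_eq)
    then obtain a where a: "a \<in> A" "rank a = Suc (y mod q)" by auto
    have "y div q < x" using Suc by (simp add: le_imp_less_Suc div_le_dividend)
    then obtain w where "w \<in> lists A" "num w = y div q" using less.IH by blast
    then show ?thesis using a Suc by (intro bexI[of _ "w @ [a]"]) auto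
  qed
qed

definition elt :: "nat \<Rightarrow> 'a" where "elt x = val (inv_into (lists A) num x)"

definition app :: "nat \<Rightarrow> 'a list \<Rightarrow> nat" where "app x v = x * q ^ length v + num v"

lemma elt_num [simp]: "w \<in> lists A \<Longrightarrow> elt (num w) = val w"
  by (simp add: elt_def num_inj)

lemma app_num: "app (num w) v = num (w @ v)"
  by (simp add: app_def num_append)

lemma elt_cases:
  assumes "A \<noteq> {}" obtains w where "w \<in> lists A" "x = num w" "elt x = val w"
  using num_surj[OF assms, of x] elt_num by metis

lemma elt_closed [simp]: "A \<noteq> {} \<Longrightarrow> elt x \<in> carrier G"
  by (metis elt_cases val_closed)

lemma elt_app [simp]: "A \<noteq> {} \<Longrightarrow> v \<in> lists A \<Longrightarrow> elt (app x v) = elt x \<otimes> val v"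
  by (metis elt_cases app_num append_in_lists_conv elt_num val_append)

lemma num_le_if_length_le:
  assumes "u \<in> lists A" "w \<in> lists A" "length u \<le> length w" shows "num u \<le> q * num w"
proof -
  have "num u < repunit (Suc (length u))" using num_length assms(1) by blast
  also have "\<dots> \<le> repunit (Suc (length w))" using assms(3) by (intro repunit_mono) simp
  also have "\<dots> = repunit (length w) * q + 1" by simp
  also have "\<dots> \<le> num w * q + 1" using num_length[OF assms(2)] by simp
  finally show ?thesis by (simp add: mult.commute)
qed

lemma num_less_power:
  assumes "w \<in> lists A" shows "num w < (q + 1) ^ length w"
proof -
  have "repunit (Suc l) \<le> (q + 1) ^ l" for l
  proof (induction l)
    case (Suc l)
    have "repunit (Suc (Suc l)) = repunit (Suc l) * q + 1" by simp
    also have "\<dots> \<le> (q + 1) ^ l * q + (q + 1) ^ l"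
      using Suc by (intro add_mono mult_le_mono1) auto
    finally show ?case by (simp add: algebra_simps)
  qed simp
  then show ?thesis using num_length[OF assms] less_le_trans by blast
qed

text \<open>
  A detour of length at most \<open>l\<close>, followed from a vertex in the ball through a given vertex, only
  involves words with numbers below this bound, which is linear in \<open>M\<close>.
\<close>

lemma num_append_less:
  assumes "u \<in> lists A" "v \<in> lists A" "w \<in> lists A" "length u \<le> length w" "length v \<le> l" "num w \<le> M"
  shows "num (u @ v) < (q * M + 1) * (q + 1) ^ l"
proof -
  have "num u \<le> q * M"
    using num_le_if_length_le[OF assms(1,3,4)] assms(6) by (meson mult_le_mono2 order_trans)
  moreover have "q ^ length v \<le> (q + 1) ^ l"
    using power_mono[of q "q + 1" "length v"] power_increasing[OF assms(5), of "q + 1"] by simp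
  ultimately have "num u * q ^ length v \<le> (q * M) * (q + 1) ^ l" by (rule mult_le_mono)
  moreover have "num v < (q + 1) ^ l"
    using num_less_power[OF assms(2)] power_increasing[OF assms(5), of "q + 1"] by simp
  ultimately show ?thesis unfolding num_append by (simp add: algebra_simps)
qed

end

context short_detours
begin

section \<open>Decidability of the word problem\<close>

definition short_relations :: "('a list \<times> 'a list) set" where
  "short_relations = {(u, v). u \<in> lists A \<and> v \<in> lists A \<and> length u \<le> K + 2 \<and> length v \<le> K + 2 \<and> val u = val v}"

lemma finite_short_relations: "finite short_relations"
proof -
  have "finite {w. set w \<subseteq> A \<and> length w \<le> K + 2}" by (rule finite_lists_length_le[OF finite_A])
  then have "finite ({w. set w \<subseteq> A \<and> length w \<le> K + 2} \<times> {w. set w \<subseteq> A \<and> length w \<le> K + 2})" by blast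
  then show ?thesis by (rule finite_subset[rotated]) (auto simp: short_relations_def in_lists_conv_set)
qed

text \<open>
  A colouring of the words with number below \<open>B\<close> that respects right multiplication by letters and
  does not distinguish words that differ by a short relation at their end.  Whether a given colouring
  has this property is decidable, as the finite set of short relations can be built into the
  decision procedure.
\<close>

definition right_congruence :: "nat \<Rightarrow> (nat \<Rightarrow> nat) \<Rightarrow> bool" where
  "right_congruence B c \<longleftrightarrow>
     (\<forall>x<B. \<forall>y<B. c x = c y \<longrightarrow>
        (\<forall>a\<in>A. app x [a] < B \<and> app y [a] < B \<longrightarrow> c (app x [a]) = c (app y [a]))) \<and>
     (\<forall>x<B. \<forall>(u, v)\<in>short_relations. app x u < B \<and> app x v < B \<longrightarrow> c (app x u) = c (app x v))"

text \<open>
  Below this bound there is room for the words no longer than the word with number \<open>M\<close>, followed by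
  one side of a short relation.
\<close>

definition bound :: "nat \<Rightarrow> nat" where "bound M = (q * M + 1) * (q + 1) ^ (K + 2)"

text \<open>
  Such a colouring is constant on the words of length at most \<open>length m\<close> that represent a given
  element.
\<close>

context
  fixes m :: "'a list" and M :: nat and c :: "nat \<Rightarrow> nat"
  assumes m: "m \<in> lists A" "num m \<le> M" and c: "right_congruence (bound M) c"
begin

lemma num_append_less_bound:
  "u \<in> lists A \<Longrightarrow> v \<in> lists A \<Longrightarrow> length u \<le> length m \<Longrightarrow> length v \<le> K + 2 \<Longrightarrow> num (u @ v) < bound M"
  unfolding bound_def by (rule num_append_less) (use m in auto)

lemma colour_letter:
  assumes "c (num u) = c (num v)" "num u < bound M" "num v < bound M" "u \<in> lists A" "v \<in> lists A" "a \<in> A"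
    and "num (u @ [a]) < bound M" "num (v @ [a]) < bound M"
  shows "c (num (u @ [a])) = c (num (v @ [a]))"
  using c assms unfolding right_congruence_def app_num[symmetric] by blast

lemma colour_relation:
  assumes "w \<in> lists A" "length w \<le> length m" "(u, v) \<in> short_relations"
  shows "c (num (w @ u)) = c (num (w @ v))"
proof -
  have "num w < bound M" "num (w @ u) < bound M" "num (w @ v) < bound M"
    using num_append_less_bound[of w "[]"] num_append_less_bound[of w u] num_append_less_bound[of w v]
      assms by (auto simp: short_relations_def)
  then show ?thesis using c assms(3) unfolding right_congruence_def app_num[symmetric] by blast
qed

text \<open>
  Along an edge, by induction on its level: a tree edge extends or retraces a normal form, and
  another edge is replaced by its detour, which consists of tree edges and edges of smaller level
  that start in the ball through the tail of the edge.
\<close>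

lemma colour_edge:
  assumes "g \<in> carrier G" "a \<in> A" "norm g \<le> length m"
  shows "c (num (nf g @ [a])) = c (num (nf (g \<otimes> a)))"
  using assms
proof (induction "level (g, a)" arbitrary: g a rule: less_induct)
  case less
  note g = less.prems
  have tree: "c (num (nf g' @ [a'])) = c (num (nf (g' \<otimes> a')))"
    if g': "g' \<in> carrier G" "a' \<in> A" "norm g' \<le> length m" "tree_edge g' a'" for g' a'
  proof (cases "nf (g' \<otimes> a') = nf g' @ [a']")
    case False
    then have *: "nf g' = nf (g' \<otimes> a') @ [inv a']" using g'(4) by (simp add: tree_edge_def)
    have "(g' \<otimes> a') \<in> carrier G" using g' by simp
    moreover have "length (nf (g' \<otimes> a')) \<le> length m"
      using * length_nf[OF g'(1)] g'(3) by (metis append_eq_conv_conj le_trans length_take min.cobounded1 nle_le)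
    moreover have "([inv a', a'], []) \<in> short_relations"
      using g' inv_A by (auto simp: short_relations_def)
    ultimately have "c (num (nf (g' \<otimes> a') @ [inv a', a'])) = c (num (nf (g' \<otimes> a') @ []))"
      using nf(1) by (intro colour_relation)
    then show ?thesis using * by simp
  qed simp
  show ?case
  proof (cases "tree_edge g a")
    case True
    then show ?thesis using tree g by blast
  next
    case False
    obtain v where v: "v \<in> lists A" "val v = a" "length v \<le> K"
      "\<And>e. e \<in> set (walk g v) \<Longrightarrow> norm (fst e) \<le> norm g \<and> (e \<in> arcs nf_tree \<or> level e < level (g, a))"
      using detour[OF g(1,2) False] by blast
    have "c (num (nf g @ u)) = c (num (nf (g \<otimes> val u)))" if "v = u @ u'" for u u'
      using that
    proof (induction u arbitrary: u' rule: rev_induct)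
      case Nil
      then show ?case using g by simp
    next
      case (snoc b u)
      have A: "u \<in> lists A" "b \<in> A" "u' \<in> lists A" using v(1) snoc.prems by auto
      have gu: "g \<otimes> val u \<in> carrier G" using g A by simp
      have "walk g v = walk g u @ walk (g \<otimes> val u) ([b] @ u')"
        using snoc.prems walk_append[OF g(1) A(1)] by simp
      then have "(g \<otimes> val u, b) \<in> set (walk g v)" by simp
      then have e: "norm (g \<otimes> val u) \<le> norm g"
        "tree_edge (g \<otimes> val u) b \<or> level (g \<otimes> val u, b) < level (g, a)"
        using v(4) by fastforce+
      have short: "length (nf g) \<le> length m" "length (nf (g \<otimes> val u)) \<le> length m"
        using length_nf g gu e(1) by auto
      have lens: "length u \<le> K + 2" "length (u @ [b]) \<le> K + 2" using v(3) snoc.prems by auto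
      have "c (num (nf g @ u)) = c (num (nf (g \<otimes> val u)))"
        using snoc.IH[of "b # u'"] snoc.prems by simp
      then have "c (num ((nf g @ u) @ [b])) = c (num (nf (g \<otimes> val u) @ [b]))"
        using num_append_less_bound[of "nf g" u] num_append_less_bound[of "nf g" "u @ [b]"]
          num_append_less_bound[of "nf (g \<otimes> val u)" "[]"] num_append_less_bound[of "nf (g \<otimes> val u)" "[b]"]
          nf(1)[OF g(1)] nf(1)[OF gu] A short lens
        by (intro colour_letter) simp_all
      also have "\<dots> = c (num (nf (g \<otimes> val u \<otimes> b)))"
        using e short gu A tree less.hyps length_nf[OF gu] by auto
      also have "g \<otimes> val u \<otimes> b = g \<otimes> val (u @ [b])"
        using g A by (simp add: m_assoc)
      finally show ?case by simp
    qed
    then have "c (num (nf g @ v)) = c (num (nf (g \<otimes> a)))" using v(2) by simp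
    moreover have "([a], v) \<in> short_relations"
      using v g by (auto simp: short_relations_def)
    ultimately show ?thesis
      using colour_relation[of "nf g" "[a]" v] nf(1)[OF g(1)] length_nf[OF g(1)] g(3) by simp
  qed
qed

lemma colour_nf:
  assumes "w \<in> lists A" "length w \<le> length m" shows "c (num w) = c (num (nf (val w)))"
  using assms
proof (induction w rule: rev_induct)
  case (snoc a w)
  have A: "w \<in> lists A" "a \<in> A" "val w \<in> carrier G" using snoc.prems by auto
  have "norm (val w) \<le> length m" using norm_le[OF A(1)] snoc.prems by simp
  then have short: "length (nf (val w)) \<le> length m" using length_nf A by simp
  have "c (num (w @ [a])) = c (num (nf (val w) @ [a]))"
    using snoc num_append_less_bound[of w "[]"] num_append_less_bound[of w "[a]"]
      num_append_less_bound[of "nf (val w)" "[]"] num_append_less_bound[of "nf (val w)" "[a]"]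
      nf(1)[OF A(3)] A short
    by (intro colour_letter) simp_all
  also have "\<dots> = c (num (nf (val w \<otimes> a)))"
    using colour_edge A \<open>norm (val w) \<le> length m\<close> by blast
  finally show ?case using A by simp
qed simp

end

text \<open>
  No right congruence separates two representatives of the same element, since it identifies both
  with their normal form (\<open>colour_nf\<close>).  Conversely, the partition into the elements represented is
  itself a right congruence and separates all other pairs.  The colourings of the numbers below
  \<open>B\<close> with colours below \<open>B\<close> are coded by the numbers below \<open>B\<^sup>B\<close>.
\<close>

lemma elt_eq_iff:
  assumes "A \<noteq> {}"
  shows "elt x = elt y \<longleftrightarrow> (\<forall>s<bound (x + y) ^ bound (x + y).
     right_congruence (bound (x + y)) (digit s (bound (x + y))) \<longrightarrow>
     digit s (bound (x + y)) x = digit s (bound (x + y)) y)" (is "?L \<longleftrightarrow> ?R")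
proof
  assume ?L
  show ?R
  proof (intro allI impI)
    fix s assume c: "right_congruence (bound (x + y)) (digit s (bound (x + y)))"
    obtain m where m: "m \<in> lists A" "num m = x + y" using num_surj[OF assms] by blast
    obtain u where u: "u \<in> lists A" "x = num u" "elt x = val u" using elt_cases[OF assms] .
    obtain v where v: "v \<in> lists A" "y = num v" "elt y = val v" using elt_cases[OF assms] .
    have "length u \<le> length m" "length v \<le> length m"
      using length_le_if_num_le m u v by auto
    then show "digit s (bound (x + y)) x = digit s (bound (x + y)) y"
      using colour_nf[OF m(1) _ c u(1)] colour_nf[OF m(1) _ c v(1)] u v m \<open>?L\<close> by simp
  qed
next
  assume R: ?R
  let ?B = "bound (x + y)"
  define c where "c z = num (nf (elt z))" for z
  have c_le: "c z \<le> z" for z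
  proof -
    obtain w where "w \<in> lists A" "z = num w" "elt z = val w" using elt_cases[OF assms] .
    then show ?thesis using num_nf_le[of "val w" w] by (simp add: c_def)
  qed
  have c_eq: "c z = c z' \<longleftrightarrow> elt z = elt z'" for z z'
    using nf assms elt_closed inj_onD[OF num_inj, of "nf (elt z)" "nf (elt z')"] unfolding c_def by metis
  obtain s where s: "s < ?B ^ ?B" "\<And>z. z < ?B \<Longrightarrow> digit s ?B z = c z"
    using exists_digits[of ?B c ?B] c_le le_less_trans by metis
  have "right_congruence ?B (digit s ?B)"
    unfolding right_congruence_def
    using s(2) assms by (auto simp: c_eq short_relations_def)
  moreover have "x < ?B" "y < ?B"
  proof -
    obtain m where m: "m \<in> lists A" "num m = x + y" using num_surj[OF assms] by blast
    have "z < ?B" if "z \<le> x + y" for z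
    proof -
      obtain w where "w \<in> lists A" "z = num w" using num_surj[OF assms] by metis
      then show ?thesis using num_append_less[of w "[]" m "K + 2" "x + y"] that m
          length_le_if_num_le[of w m] by (simp add: bound_def)
    qed
    then show "x < ?B" "y < ?B" by simp_all
  qed
  ultimately have "c x = c y" using R s by metis
  then show ?L by (simp add: c_eq)
qed

lemma recursive_fun_app [rec_intros]:
  assumes "recursive_fun n f" shows "recursive_fun n (\<lambda>xs. app (f xs) v)"
  unfolding app_def by (rule assms rec_intros)+

lemma recursive_pred_right_congruence:
  "recursive_pred 2 (\<lambda>xs. right_congruence (xs ! 1) (digit (xs ! 0) (xs ! 1)))"
proof -
  have app3: "recursive_fun (Suc (Suc 2)) (\<lambda>ys. app (hd ys) v)"
    "recursive_fun (Suc (Suc 2)) (\<lambda>ys. app (hd (tl ys)) v)" for v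
    by (rule rec_intros)+
  have colour3: "recursive_fun (Suc (Suc 2)) (\<lambda>ys. digit (tl (tl ys) ! 0) (tl (tl ys) ! 1) (f ys))"
    if "recursive_fun (Suc (Suc 2)) f" for f
    by (rule that rec_intros | simp)+
  have less3: "recursive_pred (Suc (Suc 2)) (\<lambda>ys. f ys < tl (tl ys) ! 1)"
    if "recursive_fun (Suc (Suc 2)) f" for f
    by (rule that rec_intros | simp)+
  have letters: "recursive_pred (Suc (Suc 2)) (\<lambda>ys. \<forall>a\<in>A. app (hd (tl ys)) [a] < tl (tl ys) ! 1 \<and> app (hd ys) [a] < tl (tl ys) ! 1 \<longrightarrow>
      digit (tl (tl ys) ! 0) (tl (tl ys) ! 1) (app (hd (tl ys)) [a]) = digit (tl (tl ys) ! 0) (tl (tl ys) ! 1) (app (hd ys) [a]))"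
    by (rule recursive_pred_Ball[OF finite_A] app3 colour3 less3 recursive_pred_imp recursive_pred_conj recursive_pred_eq)+
  have 1: "recursive_pred 2 (\<lambda>xs. \<forall>x<xs ! 1. \<forall>y<xs ! 1. digit (xs ! 0) (xs ! 1) x = digit (xs ! 0) (xs ! 1) y \<longrightarrow>
      (\<forall>a\<in>A. app x [a] < xs ! 1 \<and> app y [a] < xs ! 1 \<longrightarrow>
        digit (xs ! 0) (xs ! 1) (app x [a]) = digit (xs ! 0) (xs ! 1) (app y [a])))"
  proof (intro recursive_pred_all_less)
    show "recursive_pred (Suc (Suc 2)) (\<lambda>ys. digit (tl (tl ys) ! 0) (tl (tl ys) ! 1) (hd (tl ys)) =
        digit (tl (tl ys) ! 0) (tl (tl ys) ! 1) (hd ys) \<longrightarrow>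
      (\<forall>a\<in>A. app (hd (tl ys)) [a] < tl (tl ys) ! 1 \<and> app (hd ys) [a] < tl (tl ys) ! 1 \<longrightarrow>
      digit (tl (tl ys) ! 0) (tl (tl ys) ! 1) (app (hd (tl ys)) [a]) = digit (tl (tl ys) ! 0) (tl (tl ys) ! 1) (app (hd ys) [a])))"
      by (rule letters colour3 recursive_pred_imp recursive_pred_eq recursive_fun_hd recursive_fun_hd_tl)+
    show "recursive_fun (Suc 2) (\<lambda>ys. tl ys ! 1)" "recursive_fun 2 (\<lambda>xs. xs ! 1)"
      by (rule rec_intros | simp)+
  qed
  have 2: "recursive_pred 2 (\<lambda>xs. \<forall>x<xs ! 1. \<forall>t\<in>short_relations. app x (fst t) < xs ! 1 \<and> app x (snd t) < xs ! 1 \<longrightarrow>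
      digit (xs ! 0) (xs ! 1) (app x (fst t)) = digit (xs ! 0) (xs ! 1) (app x (snd t)))"
  proof (intro recursive_pred_all_less)
    show "recursive_pred (Suc 2) (\<lambda>ys. \<forall>t\<in>short_relations. app (hd ys) (fst t) < tl ys ! 1 \<and> app (hd ys) (snd t) < tl ys ! 1 \<longrightarrow>
      digit (tl ys ! 0) (tl ys ! 1) (app (hd ys) (fst t)) = digit (tl ys ! 0) (tl ys ! 1) (app (hd ys) (snd t)))"
      by (rule recursive_pred_Ball[OF finite_short_relations] rec_intros | simp)+
    show "recursive_fun 2 (\<lambda>xs. xs ! 1)"
      by (rule rec_intros | simp)+
  qed
  show ?thesis
    unfolding right_congruence_def case_prod_unfold by (intro recursive_pred_conj 1 2)
qed

lemma recursive_pred_elt_eq [rec_intros]: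
  assumes "A \<noteq> {}" "recursive_fun n f" "recursive_fun n g"
  shows "recursive_pred n (\<lambda>xs. elt (f xs) = elt (g xs))"
proof (rule recursive_pred_comp2[OF _ assms(2,3)])
  have bnd: "recursive_fun 2 (\<lambda>xs. bound (xs ! 0 + xs ! 1))"
    unfolding bound_def by (rule rec_intros | simp)+
  have bnd': "recursive_fun (Suc 2) (\<lambda>ys. bound (tl ys ! 0 + tl ys ! 1))"
    by (rule recursive_fun_tl[OF bnd])
  show "recursive_pred 2 (\<lambda>xs. elt (xs ! 0) = elt (xs ! 1))"
    unfolding elt_eq_iff[OF assms(1)]
  proof (rule recursive_pred_all_less)
    show "recursive_pred (Suc 2) (\<lambda>ys. right_congruence (bound (tl ys ! 0 + tl ys ! 1)) (digit (hd ys) (bound (tl ys ! 0 + tl ys ! 1))) \<longrightarrow>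
        digit (hd ys) (bound (tl ys ! 0 + tl ys ! 1)) (tl ys ! 0) = digit (hd ys) (bound (tl ys ! 0 + tl ys ! 1)) (tl ys ! 1))"
    proof (rule recursive_pred_imp)
      show "recursive_pred (Suc 2) (\<lambda>ys. right_congruence (bound (tl ys ! 0 + tl ys ! 1)) (digit (hd ys) (bound (tl ys ! 0 + tl ys ! 1))))"
        using recursive_pred_comp2[OF recursive_pred_right_congruence recursive_fun_hd bnd'] .
      show "recursive_pred (Suc 2) (\<lambda>ys. digit (hd ys) (bound (tl ys ! 0 + tl ys ! 1)) (tl ys ! 0) = digit (hd ys) (bound (tl ys ! 0 + tl ys ! 1)) (tl ys ! 1))"
        by (rule bnd' rec_intros | simp)+
    qed
    show "recursive_fun 2 (\<lambda>xs. bound (xs ! 0 + xs ! 1) ^ bound (xs ! 0 + xs ! 1))"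
      by (rule bnd rec_intros)+
  qed
qed

section \<open>Computability of the flow function\<close>

text \<open>
  The shortlex normal form has the least number of all representatives; it is found by minimisation,
  the word problem being decidable.
\<close>

lemma num_nf_elt_eq:
  assumes "A \<noteq> {}" shows "num (nf (elt x)) = (LEAST y. elt y = elt x)"
proof (rule Least_equality[symmetric])
  have g: "elt x \<in> carrier G" using assms by simp
  show "elt (num (nf (elt x))) = elt x" using nf[OF g] by simp
  fix y assume y: "elt y = elt x"
  obtain w where "w \<in> lists A" "y = num w" "elt y = val w" using elt_cases[OF assms] .
  then show "num (nf (elt x)) \<le> y" using num_nf_le[OF g] y by simp
qed

lemma recursive_fun_num_nf [rec_intros]:
  assumes "A \<noteq> {}" "recursive_fun n f" shows "recursive_fun n (\<lambda>xs. num (nf (elt (f xs))))"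
  unfolding num_nf_elt_eq[OF assms(1)]
proof (rule recursive_fun_Least)
  show "recursive_pred (Suc n) (\<lambda>ys. elt (hd ys) = elt (f (tl ys)))"
    by (rule assms recursive_pred_elt_eq recursive_fun_hd recursive_fun_tl)+
qed blast

lemma norm_elt_eq:
  assumes "A \<noteq> {}" shows "norm (elt x) = (LEAST l. num (nf (elt x)) < repunit (Suc l))"
proof (rule Least_equality[symmetric])
  have g: "elt x \<in> carrier G" using assms by simp
  show "num (nf (elt x)) < repunit (Suc (norm (elt x)))"
    using num_length[OF nf(1)[OF g]] length_nf[OF g] by simp
  fix l assume "num (nf (elt x)) < repunit (Suc l)"
  then have "repunit (norm (elt x)) < repunit (Suc l)"
    using num_length[OF nf(1)[OF g]] length_nf[OF g] by (simp del: repunit.simps)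
  then show "norm (elt x) \<le> l"
    using repunit_mono[of "Suc l" "norm (elt x)"] by (meson not_less not_less_eq_eq)
qed

lemma recursive_fun_norm [rec_intros]:
  assumes "A \<noteq> {}" "recursive_fun n f" shows "recursive_fun n (\<lambda>xs. norm (elt (f xs)))"
  unfolding norm_elt_eq[OF assms(1)]
proof (rule recursive_fun_Least)
  have rep: "recursive_fun k (\<lambda>xs. repunit (h xs))" if "recursive_fun k h" for k h
  proof -
    have "repunit l = rec_nat 0 (\<lambda>y v. v * q + 1) l" for l by (induction l) auto
    moreover have "recursive_fun k (\<lambda>xs. rec_nat 0 (\<lambda>y v. v * q + 1) (h xs))"
      by (rule that recursive_fun_rec_nat rec_intros)+
    ultimately show ?thesis by simp
  qed
  show "recursive_pred (Suc n) (\<lambda>ys. num (nf (elt (f (tl ys)))) < repunit (Suc (hd ys)))"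
    by (rule assms recursive_fun_tl[OF assms(2)] recursive_fun_num_nf rep recursive_pred_less
        recursive_fun_Suc recursive_fun_hd)+
  show "\<exists>l. num (nf (elt (f xs))) < repunit (Suc l)" for xs
    using num_length[OF nf(1)[of "elt (f xs)"]] assms(1) by auto
qed

lemma recursive_pred_tree_edge [rec_intros]:
  assumes "A \<noteq> {}" "a \<in> A" "recursive_fun n f"
  shows "recursive_pred n (\<lambda>xs. tree_edge (elt (f xs)) a)"
proof -
  have eq: "tree_edge (elt x) a \<longleftrightarrow>
      num (nf (elt (app x [a]))) = num (nf (elt x)) * q + rank a \<or>
      num (nf (elt x)) = num (nf (elt (app x [a]))) * q + rank (inv a)" for x
  proof -
    have g: "elt x \<in> carrier G" "elt x \<otimes> a \<in> carrier G" using assms by auto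
    have "nf (elt x \<otimes> a) = nf (elt x) @ [a] \<longleftrightarrow> num (nf (elt x \<otimes> a)) = num (nf (elt x) @ [a])"
      using nf(1)[OF g(1)] nf(1)[OF g(2)] assms(2) by (intro inj_on_eq_iff[OF num_inj, symmetric]) auto
    moreover have "nf (elt x) = nf (elt x \<otimes> a) @ [inv a] \<longleftrightarrow>
        num (nf (elt x)) = num (nf (elt x \<otimes> a) @ [inv a])"
      using nf(1)[OF g(1)] nf(1)[OF g(2)] assms(2) inv_A
      by (intro inj_on_eq_iff[OF num_inj, symmetric]) auto
    ultimately show ?thesis using assms by (simp add: tree_edge_def)
  qed
  show ?thesis unfolding eq by (rule assms(1,3) rec_intros)+
qed

lemma recursive_pred_admissible:
  assumes "A \<noteq> {}" "a \<in> A" "v \<in> lists A" "recursive_fun n f"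
  shows "recursive_pred n (\<lambda>xs. admissible (elt (f xs)) a v)"
proof -
  have eq: "admissible (elt x) a v \<longleftrightarrow> (\<forall>i\<in>{..<length v}. tree_edge (elt (app x (take i v))) (v ! i) \<or>
      norm (elt (app x (take i v))) + norm (elt (app x (take (Suc i) v)))
      < norm (elt x) + norm (elt (app x [a])))" for x
  proof -
    have g: "elt x \<in> carrier G" using assms by simp
    have "set (walk (elt x) v) = (\<lambda>i. (elt x \<otimes> val (take i v), v ! i)) ` {..<length v}"
      using nth_walk[OF g assms(3)] by (auto simp: in_set_conv_nth image_iff Bex_def) metis+
    moreover have "(elt x \<otimes> val (take i v), v ! i) \<in> arcs nf_tree \<or>
        level (elt x \<otimes> val (take i v), v ! i) < level (elt x, a) \<longleftrightarrow>
      tree_edge (elt (app x (take i v))) (v ! i) \<or>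
      norm (elt (app x (take i v))) + norm (elt (app x (take (Suc i) v)))
      < norm (elt x) + norm (elt (app x [a]))" if "i < length v" for i
      using that g assms take_lists[OF assms(3)] nth_in_A[OF assms(3) that]
        mult_val_take_Suc[OF g assms(3) that] val_closed[OF take_lists[OF assms(3), of i]]
      by (simp add: level_def)
    ultimately show ?thesis unfolding admissible_def by simp
  qed
  show ?thesis unfolding eq
  proof (rule recursive_pred_Ball)
    fix i assume "i \<in> {..<length v}"
    then have "v ! i \<in> A" using nth_in_A[OF assms(3)] by simp
    then show "recursive_pred n (\<lambda>xs. tree_edge (elt (app (f xs) (take i v))) (v ! i) \<or>
      norm (elt (app (f xs) (take i v))) + norm (elt (app (f xs) (take (Suc i) v)))
      < norm (elt (f xs)) + norm (elt (app (f xs) [a])))"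
      by (intro recursive_pred_disj recursive_pred_tree_edge recursive_pred_less recursive_fun_add
          recursive_fun_norm recursive_fun_app assms(1,4))
  qed simp
qed

lemma recursive_pred_flow_label:
  assumes "A \<noteq> {}" "a \<in> A" "recursive_fun n f"
  shows "recursive_pred n (\<lambda>xs. flow_label (elt (f xs)) a = v)"
proof -
  have eq: "flow_label (elt x) a = v \<longleftrightarrow> (tree_edge (elt x) a \<and> v = [a]) \<or>
      (\<not> tree_edge (elt x) a \<and> (\<exists>v'\<in>candidates a. v = v' \<and> admissible (elt x) a v' \<and>
        (\<forall>u\<in>candidates a. admissible (elt x) a u \<longrightarrow> num v' \<le> num u)))" for x
    using flow_label_eq_iff[of "elt x" a v] assms by auto
  have "recursive_pred n (\<lambda>xs. admissible (elt (f xs)) a u)" if "u \<in> candidates a" for u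
    using that assms by (intro recursive_pred_admissible) (auto simp: candidates_def)
  then show ?thesis unfolding eq
    by (intro recursive_pred_disj recursive_pred_conj recursive_pred_not recursive_pred_tree_edge
        recursive_pred_Bex recursive_pred_Ball recursive_pred_imp recursive_pred_const
        finite_candidates assms)
qed

text \<open>
  For each letter there are only finitely many possible labels, so that the code of the label
  need not be decoded.
\<close>

lemma recursive_triples_flow: "recursive_triples A (flow_graph G A flow)"
proof (cases "A = {}")
  case True
  then have "flow_graph G A flow = {}" by (auto simp: flow_graph_def)
  then show ?thesis
    unfolding recursive_triples_def using True recursive_fun_const[of 3 0]
    by (intro exI[of _ rank]) simp
next
  case False
  define labels where "labels a = insert [a] (candidates a)" for a
  have label: "flow_label g a \<in> labels a" if "g \<in> carrier G" "a \<in> A" for g a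
    using flow_label_nontree(1)[OF that] by (auto simp: labels_def flow_label_def)
  have horner: "code_horner q (list_encode (map rank w)) = num w" for w
    by (simp add: code_horner_list_encode num_def foldl_map)
  have eq: "xs \<in> triple_code rank ` flow_graph G A flow \<longleftrightarrow>
      (\<forall>i<xs ! 0. code_drop i (xs ! 0) = 0 \<or>
         1 \<le> code_hd (code_drop i (xs ! 0)) \<and> code_hd (code_drop i (xs ! 0)) \<le> q) \<and>
      (\<exists>a\<in>A. \<exists>v\<in>labels a. xs ! 1 = rank a \<and> xs ! 2 = list_encode (map rank v) \<and>
         flow_label (elt (code_horner q (xs ! 0))) a = v)"
    if "length xs = 3" for xs
  proof -
    have "xs = [xs ! 0, xs ! 1, xs ! 2]"
      using that by (auto simp: numeral_3_eq_3 length_Suc_conv)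
    then obtain W a' v' where xs: "xs = [W, a', v']" by blast
    have "flow_graph G A flow = {(w, a, flow_label (val w) a) | w a. w \<in> lists A \<and> a \<in> A}"
      by (auto simp: flow_graph_def flow_def)
    then have "xs \<in> triple_code rank ` flow_graph G A flow \<longleftrightarrow> (\<exists>w\<in>lists A. \<exists>a\<in>A.
        W = list_encode (map rank w) \<and> a' = rank a \<and> v' = list_encode (map rank (flow_label (val w) a)))"
      unfolding xs triple_code_def by (auto simp: image_iff)
    also have "\<dots> \<longleftrightarrow> (\<exists>w\<in>lists A. W = list_encode (map rank w)) \<and> (\<exists>a\<in>A. a' = rank a \<and>
        v' = list_encode (map rank (flow_label (elt (code_horner q W)) a)))"
    proof -
      have "elt (code_horner q W) = val w" if "w \<in> lists A" "W = list_encode (map rank w)" for w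
        using that horner by simp
      then show ?thesis by metis
    qed
    also have "(\<exists>w\<in>lists A. W = list_encode (map rank w)) \<longleftrightarrow> W \<in> list_encode ` lists {1..q}"
      unfolding rank_image[symmetric] lists_image by blast
    also have "\<dots> \<longleftrightarrow> (\<forall>i<W. code_drop i W = 0 \<or>
        1 \<le> code_hd (code_drop i W) \<and> code_hd (code_drop i W) \<le> q)"
      unfolding list_encode_in_range_iff by simp
    also have "(\<exists>a\<in>A. a' = rank a \<and> v' = list_encode (map rank (flow_label (elt (code_horner q W)) a))) \<longleftrightarrow>
        (\<exists>a\<in>A. \<exists>v\<in>labels a. a' = rank a \<and> v' = list_encode (map rank v) \<and>
         flow_label (elt (code_horner q W)) a = v)"
      using label False by auto
    finally show ?thesis unfolding xs by simp
  qed
  have n: "recursive_fun 3 (\<lambda>xs. xs ! 0)" "recursive_fun 3 (\<lambda>xs. xs ! 1)" "recursive_fun 3 (\<lambda>xs. xs ! 2)"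
    by (rule recursive_fun_nth, simp)+
  note n' = recursive_fun_tl[OF n(1)]
  have fin: "finite (labels a)" for a by (simp add: labels_def finite_candidates)
  have valid: "recursive_pred 3 (\<lambda>xs. \<forall>i<xs ! 0. code_drop i (xs ! 0) = 0 \<or>
      1 \<le> code_hd (code_drop i (xs ! 0)) \<and> code_hd (code_drop i (xs ! 0)) \<le> q)"
  proof (rule recursive_pred_all_less[OF _ n(1)])
    show "recursive_pred (Suc 3) (\<lambda>ys. code_drop (hd ys) (tl ys ! 0) = 0 \<or>
      1 \<le> code_hd (code_drop (hd ys) (tl ys ! 0)) \<and> code_hd (code_drop (hd ys) (tl ys ! 0)) \<le> q)"
      by (rule n' rec_intros)+
  qed
  have "recursive_pred 3 (\<lambda>xs. xs ! 1 = rank a \<and> xs ! 2 = list_encode (map rank v) \<and>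
      flow_label (elt (code_horner q (xs ! 0))) a = v)" if "a \<in> A" for a v
    by (intro recursive_pred_conj recursive_pred_eq recursive_pred_flow_label recursive_fun_const
        recursive_fun_code_horner n False that)
  then have "recursive_pred 3 (\<lambda>xs. \<exists>a\<in>A. \<exists>v\<in>labels a. xs ! 1 = rank a \<and>
      xs ! 2 = list_encode (map rank v) \<and> flow_label (elt (code_horner q (xs ! 0))) a = v)"
    by (intro recursive_pred_Bex finite_A fin)
  with valid have "recursive_pred 3 (\<lambda>xs. (\<forall>i<xs ! 0. code_drop i (xs ! 0) = 0 \<or>
      1 \<le> code_hd (code_drop i (xs ! 0)) \<and> code_hd (code_drop i (xs ! 0)) \<le> q) \<and>
      (\<exists>a\<in>A. \<exists>v\<in>labels a. xs ! 1 = rank a \<and> xs ! 2 = list_encode (map rank v) \<and>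
         flow_label (elt (code_horner q (xs ! 0))) a = v))"
    by (rule recursive_pred_conj)
  then have "recursive_pred 3 (\<lambda>xs. xs \<in> triple_code rank ` flow_graph G A flow)"
    by (rule recursive_pred_cong) (simp only: eq)
  then show ?thesis
    unfolding recursive_triples_def recursive_pred_def using rank_inj by blast
qed

end

section \<open>The equivalence\<close>

theorem theorem4p3:
  fixes G :: "('a, 'b) monoid_scheme" and A :: "'a set" and r :: "('a \<times> 'a) set"
  assumes "group G"
    and "finite A" and "A \<subseteq> carrier G" and "generate G A = carrier G"
    and "\<forall>a \<in> A. inv\<^bsub>G\<^esub> a \<in> A"
    and "\<one>\<^bsub>G\<^esub> \<notin> A"
    and "linear_order_on A r"
  shows "(almost_convex G A \<longleftrightarrow> geodesically_stackable G A) \<and>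
    (geodesically_stackable G A \<longleftrightarrow> geodesically_algorithmically_stackable_shortlex G A r)"
proof -
  interpret group G by (rule assms(1))
  interpret ordered_generators G A r
    using assms by unfold_locales auto
  have "almost_convex G A" if "geodesically_stackable G A"
    using that almost_convex_if_geodesic_flow unfolding geodesically_stackable_def by blast
  moreover have "geodesically_algorithmically_stackable_shortlex G A r" if ac: "almost_convex G A"
  proof -
    obtain K where "\<forall>g\<in>carrier G. \<forall>a\<in>A. \<not> tree_edge g a \<longrightarrow>
      (\<exists>v\<in>lists A. val v = a \<and> length v \<le> K \<and>
        (\<forall>e\<in>set (walk g v). norm (fst e) \<le> norm g \<and> (e \<in> arcs nf_tree \<or> level e < level (g, a))))"
      using exists_short_detours[OF ac] by blast
    then interpret short_detours G A r K
      by unfold_locales blast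
    show ?thesis
      unfolding geodesically_algorithmically_stackable_shortlex_def
      using geodesic_flow normal_forms_shortlex recursive_triples_flow by blast
  qed
  moreover have "geodesically_stackable G A"
    if "geodesically_algorithmically_stackable_shortlex G A r"
    using that unfolding geodesically_algorithmically_stackable_shortlex_def geodesically_stackable_def
    by blast
  ultimately show ?thesis by blast
qed

end
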